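(* Assume $\mathfrak b=\mathfrak c$ and that there exists a simple $P_{\mathfrak c}$-point in $\beta(\omega)$. Then every Tychonoff first-countable space of weight $<\mathfrak c$ can be densely embedded into a Tychonoff first-countable countably compact space.
   Context: $\mathfrak c$ is the cardinality of the continuum. $\mathfrak b$ is the least cardinality of a family $\Phi\subseteq\omega^\omega$ such that no $g\in\omega^\omega$ satisfies $f(n)\le g(n)$ for all but finitely many $n$, for every $f\in\Phi$. For $A,B\subseteq\omega$, $A\subseteq^* B$ means $A\setminus B$ is finite. A maximal tower is a family $\mathcal T$ of infinite subsets of $\omega$ well-ordered by $\supseteq^*$ such that no infinite $A\subseteq\omega$ satisfies $A\subseteq^*T$ for all $T\in\mathcal T$. A simple $P_{\mathfrak c}$-point is an ultrafilter on $\omega$ having a base which is a maximal tower of cardinality $\mathfrak c$. A space is countably compact if each closed discrete subset is finite. Weight is the smallest cardinality of a base. "Densely embedded into $Y$" means embedded homeomorphically as a dense subspace of $Y$. *)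

theory Defs
  imports "HOL-Analysis.Analysis"
begin

unbundle cardinal_syntax

text \<open>Cardinals are represented by cardinal orders, compared by \<open>=o\<close>, \<open>\<le>o\<close> and \<open><o\<close>;
  the choice in \<open>least_card\<close> is immaterial up to \<open>=o\<close>.\<close>

definition least_card :: "('a set \<Rightarrow> bool) \<Rightarrow> 'a rel" where
  "least_card P = |SOME A. P A \<and> (\<forall>B. P B \<longrightarrow> |A| \<le>o |B| )|"

lemma least_card_attained:
  assumes "P A"
  shows "\<exists>B. P B \<and> least_card P = |B| \<and> (\<forall>C. P C \<longrightarrow> |B| \<le>o |C| )"
proof -
  have "\<exists>r \<in> card_of ` Collect P. \<forall>r' \<in> card_of ` Collect P. r \<le>o r'"
    using assms by (intro exists_minim_Card_order) (auto simp: card_of_Card_order)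
  then have "\<exists>B. P B \<and> (\<forall>C. P C \<longrightarrow> |B| \<le>o |C| )"
    by auto
  then have "P (SOME B. P B \<and> (\<forall>C. P C \<longrightarrow> |B| \<le>o |C| )) \<and>
      (\<forall>C. P C \<longrightarrow> |SOME B. P B \<and> (\<forall>C. P C \<longrightarrow> |B| \<le>o |C| )| \<le>o |C| )"
    by (rule someI_ex)
  then show ?thesis
    unfolding least_card_def by blast
qed

definition continuum :: "real rel" where
  "continuum = |UNIV :: real set|"

definition bounding_number :: "(nat \<Rightarrow> nat) rel" where
  "bounding_number =
     least_card (\<lambda>\<Phi>. \<not> (\<exists>g. \<forall>f\<in>\<Phi>. \<forall>\<^sub>\<infinity>n. f n \<le> g n))"

definition almost_subset :: "nat set \<Rightarrow> nat set \<Rightarrow> bool"  (infix "\<subseteq>\<^sup>*" 50) where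
  "A \<subseteq>\<^sup>* B \<longleftrightarrow> finite (A - B)"

text \<open>In the well-order below, a set precedes those almost contained in it. Since
  \<^const>\<open>well_order_on\<close> includes antisymmetry, distinct members of a tower are not equal
  modulo finite sets.\<close>

definition maximal_tower :: "nat set set \<Rightarrow> bool" where
  "maximal_tower \<T> \<longleftrightarrow>
     (\<forall>T\<in>\<T>. infinite T) \<and>
     well_order_on \<T> {(A, B). A \<in> \<T> \<and> B \<in> \<T> \<and> B \<subseteq>\<^sup>* A} \<and>
     \<not> (\<exists>A. infinite A \<and> (\<forall>T\<in>\<T>. A \<subseteq>\<^sup>* T))"

definition ultrafilter :: "'a filter \<Rightarrow> bool" where
  "ultrafilter F \<longleftrightarrow>
     F \<noteq> bot \<and> (\<forall>P. eventually P F \<or> eventually (\<lambda>x. \<not> P x) F)"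

definition filter_base :: "'a filter \<Rightarrow> 'a set set \<Rightarrow> bool" where
  "filter_base F \<B> \<longleftrightarrow>
     (\<forall>B\<in>\<B>. eventually (\<lambda>x. x \<in> B) F) \<and>
     (\<forall>A. eventually (\<lambda>x. x \<in> A) F \<longrightarrow> (\<exists>B\<in>\<B>. B \<subseteq> A))"

definition simple_P_c_point :: "nat filter \<Rightarrow> bool" where
  "simple_P_c_point F \<longleftrightarrow>
     ultrafilter F \<and> (\<exists>\<T>. maximal_tower \<T> \<and> filter_base F \<T> \<and> |\<T>| =o continuum)"

definition Tychonoff_space :: "'a topology \<Rightarrow> bool" where
  "Tychonoff_space X \<longleftrightarrow> completely_regular_space X \<and> Hausdorff_space X"

definition countably_compact_space :: "'a topology \<Rightarrow> bool" where
  "countably_compact_space X \<longleftrightarrow>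
     (\<forall>C. closedin X C \<and> subtopology X C = discrete_topology C \<longrightarrow> finite C)"

definition base_of :: "'a topology \<Rightarrow> 'a set set \<Rightarrow> bool" where
  "base_of X \<B> \<longleftrightarrow> openin X = arbitrary union_of (\<lambda>B. B \<in> \<B>)"

definition weight :: "'a topology \<Rightarrow> 'a set rel" where
  "weight X = least_card (base_of X)"

text \<open>Since types cannot be quantified existentially, an extension of a space on \<open>'a\<close> is
  sought on the carrier type \<open>'a + real\<close>. This loses nothing for first-countable Hausdorff
  extensions of spaces of weight below the continuum: they have a dense subset of size at
  most the continuum, hence at most continuum many points.\<close>

definition densely_embeds :: "'a topology \<Rightarrow> 'b topology \<Rightarrow> bool" where
  "densely_embeds X Y \<longleftrightarrow>
     (\<exists>f. embedding_map X Y f \<and> Y closure_of (f ` topspace X) = topspace Y)"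

end

theory Submission
  imports Defs
begin

text \<open>Represent a space by coordinate functions into \<open>[0,1]\<close>, fewer than continuum many, in such a
  way that countably many of them determine the neighbourhoods of any given point. A sequence
  without accumulation point has a subsequence along which all coordinates converge, by the simple
  \<open>P\<^sub>c\<close>-point. By \<open>b = c\<close> the terms of the subsequence have neighbourhoods on which each
  coordinate oscillates less and less; these are locally finite, and bump functions supported in
  them combine into one new coordinate which reaches 1 exactly at the limit point to be adjoined.
  This coordinate alone determines the neighbourhoods of the new point, and since the old space is
  dense, every neighbourhood base survives all later extensions. Adjoin limit points in this way for
  continuum many stages, listing all sequences cofinally often; a countable subset of the union
  appears at some stage because \<open>b = c\<close> bounds countable unions of sets smaller than the continuum.\<close>

section \<open>Small families and convergent subsequences\<close>

text \<open>The obstacle is to keep first countability while both points and coordinates are added: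
  a coordinate created later has to be continuous at every older point with respect to the countable
  base fixed there. So a new coordinate is made continuous on the space present at its stage, and
  its value at still later points is not chosen freely but is the limit that comes with those
  points.

  Both hypotheses apply only to fewer than continuum many coordinates. Weight below the continuum
  ensures this at the start, and a well-order whose proper initial segments are smaller than the
  continuum ensures it at each stage.

  A tower of size continuum might a priori have small cofinality. That fewer than continuum many
  members of the ultrafilter have a common pseudo-intersection is therefore itself derived from b =
  c: a small cofinal subfamily of the tower could be split by one set, which the ultrafilter would
  be unable to decide.\<close>

lemma lepoll_iff_card_of: "A \<lesssim> B \<longleftrightarrow> |A| \<le>o |B|"
  unfolding lepoll_def card_of_ordLeq[symmetric] by blast

lemma not_card_of_ordLess: "\<not> |A| <o |B| \<longleftrightarrow> |B| \<le>o |A|"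
  using not_ordLess_iff_ordLeq[OF card_of_Well_order card_of_Well_order] by blast

section \<open>Cardinality of spaces of sequences\<close>

lemma sequences_lepoll_reals: "(UNIV :: (nat \<Rightarrow> real) set) \<lesssim> (UNIV :: real set)"
proof -
  obtain j :: "real \<Rightarrow> nat set" where j: "inj j"
    using eqpoll_imp_lepoll[OF eqpoll_sym[OF nat_sets_eqpoll_reals]] unfolding lepoll_def by blast
  \<comment> \<open>The sets \<open>j (f n)\<close> are placed side by side, one row of the pairing
    for each n, so that \<open>code f\<close> recovers all of them.\<close>
  define code where "code f = {prod_encode (n, m) |n m. m \<in> j (f n)}" for f :: "nat \<Rightarrow> real"
  have "f = g" if "code f = code g" for f g
  proof
    fix n
    have "m \<in> j (f n) \<longleftrightarrow> m \<in> j (g n)" for m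
    proof -
      have "m \<in> j (h n) \<longleftrightarrow> prod_encode (n, m) \<in> code h" for h
        by (auto simp: code_def)
      then show ?thesis
        using that by simp
    qed
    then have "j (f n) = j (g n)"
      by blast
    then show "f n = g n"
      using j by (simp add: inj_eq)
  qed
  then have "inj code"
    by (rule injI)
  then have "(UNIV :: (nat \<Rightarrow> real) set) \<lesssim> (UNIV :: nat set set)"
    unfolding lepoll_def by blast
  then show ?thesis
    using eqpoll_imp_lepoll[OF nat_sets_eqpoll_reals] lepoll_trans by blast
qed

lemma function_space_lepoll_reals:
  fixes S :: "'b set"
  assumes "S \<lesssim> (UNIV :: real set)"
  shows "{s :: nat \<Rightarrow> 'b. range s \<subseteq> S} \<lesssim> (UNIV :: real set)"
proof -
  obtain j :: "'b \<Rightarrow> real" where j: "inj_on j S"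
    using assms unfolding lepoll_def by blast
  have "inj_on (\<lambda>s n. j (s n)) {s :: nat \<Rightarrow> 'b. range s \<subseteq> S}"
  proof (rule inj_onI, rule ext)
    fix s t :: "nat \<Rightarrow> 'b" and n
    assume "s \<in> {s. range s \<subseteq> S}" "t \<in> {s. range s \<subseteq> S}" "(\<lambda>n. j (s n)) = (\<lambda>n. j (t n))"
    then show "s n = t n"
      by (metis (mono_tags, lifting) inj_onD[OF j] mem_Collect_eq rangeI subsetD)
  qed
  then have "{s :: nat \<Rightarrow> 'b. range s \<subseteq> S} \<lesssim> (UNIV :: (nat \<Rightarrow> real) set)"
    unfolding lepoll_def by blast
  then show ?thesis
    using sequences_lepoll_reals lepoll_trans by blast
qed

section \<open>Consequences of b = c for sets smaller than the continuum\<close>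

lemma unbounded_family_exists: "\<not> (\<exists>g. \<forall>f\<in>UNIV. \<forall>\<^sub>\<infinity>n. f n \<le> (g :: nat \<Rightarrow> nat) n)"
proof
  assume "\<exists>g. \<forall>f\<in>UNIV. \<forall>\<^sub>\<infinity>n. f n \<le> (g :: nat \<Rightarrow> nat) n"
  then obtain g :: "nat \<Rightarrow> nat" where "\<And>f. \<forall>\<^sub>\<infinity>n. f n \<le> g n"
    by blast
  from this[of "\<lambda>n. Suc (g n)"] show False
    by (simp add: MOST_nat)
qed

text \<open>\<open>bounding_number\<close> refers to a chosen minimal family. The choice is genuine
  because the set of all functions is unbounded, and minimality then transfers along the equality
  with the continuum.\<close>

lemma obtain_least_unbounded_family:
  assumes "bounding_number =o continuum"
  obtains B where "\<not> (\<exists>g. \<forall>f\<in>B. \<forall>\<^sub>\<infinity>n. f n \<le> (g :: nat \<Rightarrow> nat) n)" "|B| =o |UNIV :: real set|"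
    "\<And>C. |C| <o |UNIV :: real set| \<Longrightarrow> \<exists>g. \<forall>f\<in>C. \<forall>\<^sub>\<infinity>n. f n \<le> (g :: nat \<Rightarrow> nat) n"
proof -
  obtain B where B: "\<not> (\<exists>g. \<forall>f\<in>B. \<forall>\<^sub>\<infinity>n. f n \<le> (g :: nat \<Rightarrow> nat) n)" "bounding_number = |B|"
     "\<And>C. \<not> (\<exists>g. \<forall>f\<in>C. \<forall>\<^sub>\<infinity>n. f n \<le> (g :: nat \<Rightarrow> nat) n) \<Longrightarrow> |B| \<le>o |C|"
    using least_card_attained[of "\<lambda>\<Phi>. \<not> (\<exists>g. \<forall>f\<in>\<Phi>. \<forall>\<^sub>\<infinity>n. f n \<le> (g :: nat \<Rightarrow> nat) n)", OF unbounded_family_exists]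
    unfolding bounding_number_def by blast
  have eq: "|B| =o |UNIV :: real set|"
    using assms B(2) by (simp add: continuum_def)
  show ?thesis
  proof (rule that[OF B(1) eq])
    fix C :: "(nat \<Rightarrow> nat) set" assume "|C| <o |UNIV :: real set|"
    then have "|C| <o |B|"
      using eq ordIso_symmetric ordLess_ordIso_trans by blast
    then show "\<exists>g. \<forall>f\<in>C. \<forall>\<^sub>\<infinity>n. f n \<le> g n"
      using B(3)[of C] not_ordLess_ordLeq by blast
  qed
qed

lemma eventually_bounded_family:
  fixes \<Phi> :: "(nat \<Rightarrow> nat) set"
  assumes "bounding_number =o continuum" "|\<Phi>| <o |UNIV :: real set|"
  shows "\<exists>g. \<forall>f\<in>\<Phi>. \<forall>\<^sub>\<infinity>n. f n \<le> g n"
  using obtain_least_unbounded_family[OF assms(1)] assms(2) by blast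

text \<open>Were the union of size continuum, it would index an unbounded family of least size. This
  would fall into countably many smaller, hence bounded, pieces, and countably many bounds have a
  common eventual bound.\<close>

lemma countable_union_below_continuum:
  fixes A :: "nat \<Rightarrow> 'b set"
  assumes "bounding_number =o continuum" "\<And>n. |A n| <o |UNIV :: real set|"
  shows "|\<Union>n. A n| <o |UNIV :: real set|"
proof (rule ccontr)
  assume "\<not> ?thesis"
  then have large: "|UNIV :: real set| \<le>o |\<Union>n. A n|"
    by (simp add: not_card_of_ordLess)
  obtain B where B: "\<not> (\<exists>g. \<forall>f\<in>B. \<forall>\<^sub>\<infinity>n. f n \<le> (g :: nat \<Rightarrow> nat) n)" "|B| =o |UNIV :: real set|"
    "\<And>C. |C| <o |UNIV :: real set| \<Longrightarrow> \<exists>g. \<forall>f\<in>C. \<forall>\<^sub>\<infinity>n. f n \<le> (g :: nat \<Rightarrow> nat) n"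
    using obtain_least_unbounded_family[OF assms(1)] by blast
  have "|B| \<le>o |\<Union>n. A n|"
    using B(2) large ordIso_ordLeq_trans by blast
  then obtain h where h: "inj_on h B" "h ` B \<subseteq> (\<Union>n. A n)"
    unfolding card_of_ordLeq[symmetric] by blast
  have "\<exists>g. \<forall>f\<in>{f \<in> B. h f \<in> A n}. \<forall>\<^sub>\<infinity>m. f m \<le> (g :: nat \<Rightarrow> nat) m" for n
  proof (rule B(3))
    have "|{f \<in> B. h f \<in> A n}| \<le>o |A n|"
      using h(1) unfolding card_of_ordLeq[symmetric]
      by (intro exI[of _ h]) (auto simp: inj_on_def)
    then show "|{f \<in> B. h f \<in> A n}| <o |UNIV :: real set|"
      using assms(2) ordLeq_ordLess_trans by blast
  qed
  then have "\<exists>g. \<forall>n. \<forall>f\<in>{f \<in> B. h f \<in> A n}. \<forall>\<^sub>\<infinity>m. f m \<le> (g n :: nat \<Rightarrow> nat) m"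
    by (intro choice allI)
  then obtain g where g: "\<And>n f. f \<in> B \<Longrightarrow> h f \<in> A n \<Longrightarrow> \<forall>\<^sub>\<infinity>m. f m \<le> (g n :: nat \<Rightarrow> nat) m"
    by blast
  \<comment> \<open>The diagonal sum has \<open>g n m\<close> as a summand from m = n on, so it
    eventually dominates each of the countably many bounds.\<close>
  define G where "G m = (\<Sum>n\<le>m. g n m)" for m
  have "\<forall>\<^sub>\<infinity>m. f m \<le> G m" if "f \<in> B" for f
  proof -
    obtain n where n: "h f \<in> A n"
      using h(2) \<open>f \<in> B\<close> by blast
    have "\<forall>\<^sub>\<infinity>m. n \<le> m"
      by (auto simp: MOST_nat_le)
    with g[OF \<open>f \<in> B\<close> n] show ?thesis
    proof eventually_elim
      case (elim m)
      have "g n m \<le> G m"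
        unfolding G_def using elim(2) by (intro member_le_sum) auto
      with elim(1) show ?case
        by simp
    qed
  qed
  then show False
    using B(1) by blast
qed

lemma card_of_Times_ordLess:
  assumes "infinite C" "|A| <o |C|" "|B| <o |C|"
  shows "|A \<times> B| <o |C|"
proof (cases "finite (A <+> B)")
  case True
  then have "finite (A \<times> B)"
    by (simp add: finite_Plus_iff)
  then show ?thesis
    using assms(1) by (intro finite_ordLess_infinite card_of_Well_order) (simp_all add: Field_card_of)
next
  case False
  have "A \<times> B \<lesssim> (A <+> B) \<times> (A <+> B)"
    unfolding lepoll_def
  proof (intro exI conjI)
    show "inj_on (map_prod Inl Inr) (A \<times> B)"
      by (simp add: inj_on_def)
    show "map_prod Inl Inr ` (A \<times> B) \<subseteq> (A <+> B) \<times> (A <+> B)"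
      by auto
  qed
  then have "|A \<times> B| \<le>o |(A <+> B) \<times> (A <+> B)|"
    by (simp add: lepoll_iff_card_of)
  also have "|(A <+> B) \<times> (A <+> B)| =o |A <+> B|"
    by (rule card_of_Times_same_infinite[OF False])
  also have "|A <+> B| <o |C|"
    using assms by (rule card_of_Plus_ordLess_infinite)
  finally show ?thesis .
qed

lemma countable_below_continuum:
  assumes "countable S"
  shows "|S| <o |UNIV :: real set|"
proof (rule ccontr)
  assume "\<not> ?thesis"
  then have "(UNIV :: real set) \<lesssim> S"
    by (simp add: lepoll_iff_card_of not_card_of_ordLess)
  then show False
    using assms countable_lepoll uncountable_UNIV_real by blast
qed

lemma times_nat_below_continuum:
  assumes "|S| <o |UNIV :: real set|"
  shows "|S \<times> (UNIV :: nat set)| <o |UNIV :: real set|"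
  by (intro card_of_Times_ordLess assms countable_below_continuum) (auto simp: infinite_UNIV_char_0)

text \<open>An interval partition dominating the next-element functions of all members of the
  family; the union of its even intervals then splits every member.\<close>

lemma splitting_small_family:
  fixes \<S> :: "nat set set"
  assumes b: "bounding_number =o continuum" and small: "|\<S>| <o |UNIV :: real set|"
    and inf: "\<And>S. S \<in> \<S> \<Longrightarrow> infinite S"
  obtains E where "\<And>S. S \<in> \<S> \<Longrightarrow> infinite (S \<inter> E) \<and> infinite (S - E)"
proof -
  define nxt where "nxt S n = (LEAST m. m \<in> S \<and> n \<le> m)" for S :: "nat set" and n
  have nxt: "nxt S n \<in> S \<and> n \<le> nxt S n" if "S \<in> \<S>" for S n
  proof -
    have "\<exists>m. m \<in> S \<and> n \<le> m"
      using inf[OF that] unfolding infinite_nat_iff_unbounded_le by blast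
    then show ?thesis
      unfolding nxt_def by (rule LeastI_ex)
  qed
  have "|nxt ` \<S>| <o |UNIV :: real set|"
    using small card_of_image ordLeq_ordLess_trans by blast
  from eventually_bounded_family[OF b this]
  obtain g where g: "\<And>S. S \<in> \<S> \<Longrightarrow> \<forall>\<^sub>\<infinity>n. nxt S n \<le> g n"
    unfolding ball_simps by blast
  \<comment> \<open>Jumping past \<open>g (a k)\<close> leaves room in the k-th interval for the
    first element of S at or above \<open>a k\<close>, once k is large.\<close>
  define a where "a k = ((\<lambda>n. Suc (n + g n)) ^^ k) 0" for k
  have a_Suc: "a (Suc k) = Suc (a k + g (a k))" for k
    by (simp add: a_def)
  have "strict_mono a"
    by (rule strict_monoI_Suc) (simp add: a_Suc)
  define E where "E = (\<Union>k. {a (2 * k)..<a (Suc (2 * k))})"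
  have meets: "\<forall>\<^sub>\<infinity>k. \<exists>m\<in>S. a k \<le> m \<and> m < a (Suc k)" if S: "S \<in> \<S>" for S
  proof -
    obtain n0 where n0: "\<And>n. n \<ge> n0 \<Longrightarrow> nxt S n \<le> g n"
      using g[OF S] unfolding MOST_nat_le by blast
    have "\<exists>m\<in>S. a k \<le> m \<and> m < a (Suc k)" if "k \<ge> n0" for k
    proof -
      have "nxt S (a k) \<le> g (a k)"
        by (rule n0) (use that strict_mono_imp_increasing[OF \<open>strict_mono a\<close>, of k] in linarith)
      then show ?thesis
        using nxt[OF \<open>S \<in> \<S>\<close>, of "a k"] by (intro bexI[of _ "nxt S (a k)"]) (simp_all add: a_Suc)
    qed
    then show ?thesis
      unfolding MOST_nat_le by blast
  qed
  have same: "j = k" if "a j \<le> m" "m < a (Suc j)" "a k \<le> m" "m < a (Suc k)" for j k m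
  proof (rule ccontr)
    assume "j \<noteq> k"
    then have "Suc j \<le> k \<or> Suc k \<le> j"
      by linarith
    then show False
      using that strict_mono_less_eq[OF \<open>strict_mono a\<close>, of "Suc j" k]
        strict_mono_less_eq[OF \<open>strict_mono a\<close>, of "Suc k" j] by linarith
  qed
  show ?thesis
  proof (rule that)
    fix S assume S: "S \<in> \<S>"
    obtain k0 where k0: "\<And>k. k \<ge> k0 \<Longrightarrow> \<exists>m\<in>S. a k \<le> m \<and> m < a (Suc k)"
      using meets[OF S] unfolding MOST_nat_le by blast
    have "\<exists>m\<ge>n. m \<in> S \<inter> E" for n
    proof -
      obtain m where "m \<in> S" "a (2 * (k0 + n)) \<le> m" "m < a (Suc (2 * (k0 + n)))"
        using k0[of "2 * (k0 + n)"] by auto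
      moreover have "n \<le> a (2 * (k0 + n))"
        by (rule order_trans[OF _ strict_mono_imp_increasing[OF \<open>strict_mono a\<close>]]) simp
      moreover have "m \<in> E"
        unfolding E_def using calculation(2,3) by (intro UN_I[of "k0 + n"]) simp_all
      ultimately show ?thesis
        by (intro exI[of _ m] conjI IntI) linarith+
    qed
    moreover have "\<exists>m\<ge>n. m \<in> S - E" for n
    proof -
      obtain m where m: "m \<in> S" "a (Suc (2 * (k0 + n))) \<le> m" "m < a (Suc (Suc (2 * (k0 + n))))"
        using k0[of "Suc (2 * (k0 + n))"] by auto
      moreover have "n \<le> a (Suc (2 * (k0 + n)))"
        by (rule order_trans[OF _ strict_mono_imp_increasing[OF \<open>strict_mono a\<close>]]) simp
      moreover have "m \<notin> E"
      proof
        assume "m \<in> E"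
        then obtain k where "a (2 * k) \<le> m" "m < a (Suc (2 * k))"
          by (auto simp: E_def)
        then have "2 * k = Suc (2 * (k0 + n))"
          using same m by blast
        then show False
          by presburger
      qed
      ultimately show ?thesis
        by (intro exI[of _ m] conjI DiffI) linarith+
    qed
    ultimately show "infinite (S \<inter> E) \<and> infinite (S - E)"
      unfolding infinite_nat_iff_unbounded_le by blast
  qed
qed

section \<open>Pseudo-intersections of small subfamilies of the ultrafilter\<close>

lemma ultrafilter_eventually_not:
  assumes "ultrafilter F" "\<not> eventually P F"
  shows "eventually (\<lambda>x. \<not> P x) F"
  using assms unfolding ultrafilter_def by blast

text \<open>Each A is first shrunk to a tower member \<open>\<tau> A\<close>. If no tower member
  were almost contained in all of these, linearity would put some \<open>\<tau> A\<close> almost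
  below every tower member. A set E splitting all \<open>\<tau> A\<close> then contains no tower
  member, and neither does its complement, although the ultrafilter must contain one of the
  two.\<close>

lemma simple_P_c_point_small_pseudo_intersection:
  assumes b: "bounding_number =o continuum" and F: "simple_P_c_point F"
    and \<A>: "|\<A>| <o |UNIV :: real set|" "\<And>A. A \<in> \<A> \<Longrightarrow> eventually (\<lambda>n. n \<in> A) F"
  obtains T where "infinite T" "\<And>A. A \<in> \<A> \<Longrightarrow> T \<subseteq>\<^sup>* A"
proof -
  obtain \<T> where \<T>: "maximal_tower \<T>" "filter_base F \<T>" and ultra: "ultrafilter F"
    using F unfolding simple_P_c_point_def by blast
  have inf: "\<And>T. T \<in> \<T> \<Longrightarrow> infinite T"
    using \<T>(1) unfolding maximal_tower_def by blast
  have lin: "S \<subseteq>\<^sup>* T \<or> T \<subseteq>\<^sup>* S" if "S \<in> \<T>" "T \<in> \<T>" for S T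
  proof (cases "S = T")
    case True
    then show ?thesis by (simp add: almost_subset_def)
  next
    case False
    then show ?thesis
      using \<T>(1) that
      unfolding maximal_tower_def well_order_on_def linear_order_on_def total_on_def by blast
  qed
  obtain \<tau> where \<tau>: "\<And>A. A \<in> \<A> \<Longrightarrow> \<tau> A \<in> \<T> \<and> \<tau> A \<subseteq> A"
    using \<A>(2) \<T>(2) unfolding filter_base_def by metis
  have "\<exists>T\<in>\<T>. \<forall>A\<in>\<A>. T \<subseteq>\<^sup>* \<tau> A"
  proof (rule ccontr)
    assume neg: "\<not> ?thesis"
    have small: "|\<tau> ` \<A>| <o |UNIV :: real set|"
      using \<A>(1) card_of_image ordLeq_ordLess_trans by blast
    obtain E where E: "\<And>S. S \<in> \<tau> ` \<A> \<Longrightarrow> infinite (S \<inter> E) \<and> infinite (S - E)"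
      using splitting_small_family[OF b small] \<tau> inf by blast
    have no: "\<not> eventually (\<lambda>n. n \<in> D) F" if D: "\<And>S. S \<in> \<tau> ` \<A> \<Longrightarrow> infinite (S - D)" for D
    proof
      assume "eventually (\<lambda>n. n \<in> D) F"
      then obtain T where T: "T \<in> \<T>" "T \<subseteq> D"
        using \<T>(2) unfolding filter_base_def by blast
      then obtain A where A: "A \<in> \<A>" "\<not> T \<subseteq>\<^sup>* \<tau> A"
        using neg by blast
      then have "\<tau> A \<subseteq>\<^sup>* T"
        using lin[of T "\<tau> A"] T(1) \<tau> by blast
      then have "finite (\<tau> A - D)"
        unfolding almost_subset_def by (rule finite_subset[rotated]) (use T(2) in blast)
      then show False
        using D A(1) by blast
    qed
    have "\<not> eventually (\<lambda>n. n \<in> E) F"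
      by (rule no) (use E in blast)
    then have "eventually (\<lambda>n. n \<in> - E) F"
      using ultrafilter_eventually_not[OF ultra] by (metis (mono_tags, lifting) ComplI eventually_mono)
    moreover have "\<not> eventually (\<lambda>n. n \<in> - E) F"
      by (rule no) (use E in \<open>auto simp: Diff_Compl\<close>)
    ultimately show False
      by blast
  qed
  then obtain T where T: "T \<in> \<T>" "\<And>A. A \<in> \<A> \<Longrightarrow> T \<subseteq>\<^sup>* \<tau> A"
    by blast
  show ?thesis
  proof (rule that)
    show "infinite T" by (rule inf[OF T(1)])
    fix A assume "A \<in> \<A>"
    then show "T \<subseteq>\<^sup>* A"
      using T(2)[of A] \<tau>[of A] unfolding almost_subset_def
      by (meson Diff_mono finite_subset order_refl)
  qed
qed

text \<open>The ultrafilter prescribes all the limits at once, and the pseudo-intersection of the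
  fewer than continuum many members of it involved realises them along one subsequence.\<close>

lemma simultaneous_convergent_subsequence:
  fixes u :: "'j \<Rightarrow> nat \<Rightarrow> real"
  assumes b: "bounding_number =o continuum" and F: "simple_P_c_point F"
    and J: "|J| <o |UNIV :: real set|" and bnd: "\<And>i n. i \<in> J \<Longrightarrow> u i n \<in> {0..1}"
  obtains v r where "strict_mono (r :: nat \<Rightarrow> nat)" "\<And>i. i \<in> J \<Longrightarrow> v i \<in> {0..1}"
    "\<And>i. i \<in> J \<Longrightarrow> (\<lambda>n. u i (r n)) \<longlonglongrightarrow> v i"
proof -
  have ultra: "ultrafilter F" and nb: "F \<noteq> bot"
    using F unfolding simple_P_c_point_def ultrafilter_def by blast+
  have "\<exists>l\<in>{0..1}. (u i \<longlongrightarrow> l) F" if "i \<in> J" for i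
  proof -
    \<comment> \<open>Compactness yields a cluster point of the image filter; since the ultrafilter
      decides every neighbourhood of it, the cluster point is a limit.\<close>
    have "\<exists>l\<in>{0..1}. inf (nhds l) (filtermap (u i) F) \<noteq> bot"
      using compact_Icc[of "0::real" 1] bnd[OF that] nb unfolding compact_filter
      by (metis (mono_tags, lifting) always_eventually eventually_filtermap filtermap_bot_iff)
    then obtain l where l: "l \<in> {0..1}" "inf (nhds l) (filtermap (u i) F) \<noteq> bot"
      by blast
    have "eventually (\<lambda>n. u i n \<in> S) F" if S: "open S" "l \<in> S" for S
    proof (rule ccontr)
      assume "\<not> eventually (\<lambda>n. u i n \<in> S) F"
      then have "eventually (\<lambda>x. x \<notin> S) (filtermap (u i) F)"
        using ultrafilter_eventually_not[OF ultra] by (simp add: eventually_filtermap)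
      moreover have "eventually (\<lambda>x. x \<in> S) (nhds l)"
        using S by (simp add: eventually_nhds_in_open)
      ultimately have "eventually (\<lambda>_. False) (inf (nhds l) (filtermap (u i) F))"
        unfolding eventually_inf by blast
      then show False
        using l(2) by (simp add: eventually_False)
    qed
    then show ?thesis
      using l(1) unfolding tendsto_def by blast
  qed
  then obtain v where v: "\<And>i. i \<in> J \<Longrightarrow> v i \<in> {0..1}" "\<And>i. i \<in> J \<Longrightarrow> (u i \<longlongrightarrow> v i) F"
    by metis
  \<comment> \<open>Convergence of one coordinate amounts to countably many requirements, so there
    are still fewer than continuum many sets in which T has to be almost contained.\<close>
  define near where "near = (\<lambda>(i, k :: nat). {n. dist (u i n) (v i) < inverse (Suc k)})"
  have "|near ` (J \<times> (UNIV :: nat set))| <o |UNIV :: real set|"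
    using times_nat_below_continuum[OF J] card_of_image ordLeq_ordLess_trans by blast
  moreover have "eventually (\<lambda>n. n \<in> A) F" if A: "A \<in> near ` (J \<times> UNIV)" for A
    using A v(2) by (auto simp: near_def intro!: tendstoD)
  ultimately obtain T where T: "infinite T" "\<And>A. A \<in> near ` (J \<times> UNIV) \<Longrightarrow> T \<subseteq>\<^sup>* A"
    using simple_P_c_point_small_pseudo_intersection[OF b F] by blast
  have r: "strict_mono (enumerate T)" "\<And>n. enumerate T n \<in> T"
    using T(1) by (auto simp: strict_mono_def enumerate_mono enumerate_in_set)
  show ?thesis
  proof (rule that[OF r(1) v(1)])
    fix i assume i: "i \<in> J"
    show "(\<lambda>n. u i (enumerate T n)) \<longlonglongrightarrow> v i"
    proof (rule tendstoI)
      fix e :: real assume "e > 0"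
      then obtain k where k: "inverse (real (Suc k)) < e"
        using reals_Archimedean by blast
      have "finite (T - near (i, k))"
        using T(2)[of "near (i, k)"] i by (auto simp: almost_subset_def)
      then have "finite {n. enumerate T n \<in> T - near (i, k)}"
        using finite_vimageI[OF _ strict_mono_imp_inj_on[OF r(1)], of "T - near (i, k)"]
        by (simp only: vimage_def)
      then have "\<forall>\<^sub>\<infinity>n. enumerate T n \<in> near (i, k)"
        using r(2) by (simp add: MOST_iff_finiteNeg)
      then show "\<forall>\<^sub>F n in sequentially. dist (u i (enumerate T n)) (v i) < e"
        unfolding cofinite_eq_sequentially
      proof eventually_elim
        case (elim n)
        then show ?case
          using k by (simp add: near_def)
      qed
    qed
  qed auto
qed

section \<open>Coordinate systems and their limit points\<close>

text \<open>The index k bounds both the number of coordinates and the radius, so the sets decrease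
  in k. The point p need not belong to P: with P a dense subset, these are the traces on P of the
  neighbourhoods of a point of the extension.\<close>

definition basic_nbhd ::
    "('j \<Rightarrow> 'p \<Rightarrow> real) \<Rightarrow> ('p \<Rightarrow> nat \<Rightarrow> 'j) \<Rightarrow> 'p set \<Rightarrow> 'p \<Rightarrow> nat \<Rightarrow> 'p set" where
  "basic_nbhd E c P p k = {q \<in> P. \<forall>j\<le>k. \<bar>E (c p j) q - E (c p j) p\<bar> < 1 / Suc k}"

definition nbhd_filter ::
    "('j \<Rightarrow> 'p \<Rightarrow> real) \<Rightarrow> ('p \<Rightarrow> nat \<Rightarrow> 'j) \<Rightarrow> 'p set \<Rightarrow> 'p \<Rightarrow> 'p filter" where
  "nbhd_filter E c P p = (INF k. principal (basic_nbhd E c P p k))"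

lemma basic_nbhd_antimono: "k \<le> l \<Longrightarrow> basic_nbhd E c P p l \<subseteq> basic_nbhd E c P p k"
proof -
  assume "k \<le> l"
  then have "1 / real (Suc l) \<le> 1 / real (Suc k)"
    by (simp add: frac_le)
  with \<open>k \<le> l\<close> show ?thesis
    unfolding basic_nbhd_def by (smt (verit) Collect_mono le_trans)
qed

lemma basic_nbhd_self: "p \<in> P \<Longrightarrow> p \<in> basic_nbhd E c P p k"
  by (simp add: basic_nbhd_def)

lemma basic_nbhd_subset: "basic_nbhd E c P p k \<subseteq> P"
  by (auto simp: basic_nbhd_def)

lemma eventually_nbhd_filter:
  "eventually Q (nbhd_filter E c P p) \<longleftrightarrow> (\<exists>k. \<forall>q\<in>basic_nbhd E c P p k. Q q)"
proof -
  have "\<exists>x\<in>UNIV. principal (basic_nbhd E c P p x)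
      \<le> inf (principal (basic_nbhd E c P p a)) (principal (basic_nbhd E c P p b))" for a b
    using basic_nbhd_antimono[of a "max a b" E c P p] basic_nbhd_antimono[of b "max a b" E c P p]
    by (intro bexI[of _ "max a b"]) auto
  then show ?thesis
    unfolding nbhd_filter_def by (subst eventually_INF_base) (auto simp: eventually_principal)
qed

lemma nbhd_filter_mono: "P \<subseteq> Q \<Longrightarrow> nbhd_filter E c P p \<le> nbhd_filter E c Q p"
  unfolding nbhd_filter_def basic_nbhd_def by (intro INF_mono) (auto intro!: bexI)

lemma eventually_nbhd_filter_self: "eventually Q (nbhd_filter E c P p) \<Longrightarrow> p \<in> P \<Longrightarrow> Q p"
  unfolding eventually_nbhd_filter using basic_nbhd_self by fastforce

lemma nbhd_filter_neq_bot:
  assumes "\<And>k. basic_nbhd E c P p k \<noteq> {}"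
  shows "nbhd_filter E c P p \<noteq> bot"
  using assms unfolding trivial_limit_def eventually_nbhd_filter by blast

text \<open>A set of points \<open>P\<close> with the initial topology of the coordinates \<open>E i\<close>, where countably
  many coordinates \<open>c p 0, c p 1, \<dots>\<close> already determine the neighbourhoods of \<open>p\<close>.\<close>

locale coordinate_system =
  fixes P :: "'p set" and J :: "'j set" and E :: "'j \<Rightarrow> 'p \<Rightarrow> real" and c :: "'p \<Rightarrow> nat \<Rightarrow> 'j"
  assumes c_in: "p \<in> P \<Longrightarrow> c p n \<in> J"
    and tends: "p \<in> P \<Longrightarrow> i \<in> J \<Longrightarrow> (E i \<longlongrightarrow> E i p) (nbhd_filter E c P p)"
begin

text \<open>This is openness of the basic neighbourhoods. Only finitely many strict inequalities are
  involved, and the coordinates of p converge at q by \<open>tends\<close>, although they need not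
  be among those that define the base at q.\<close>

lemma eventually_basic_nbhd:
  assumes "p \<in> P" "q \<in> basic_nbhd E c P p k"
  shows "eventually (\<lambda>x. x \<in> basic_nbhd E c P p k) (nbhd_filter E c P q)"
proof -
  have q: "q \<in> P" "\<And>j. j \<le> k \<Longrightarrow> \<bar>E (c p j) q - E (c p j) p\<bar> < 1 / Suc k"
    using assms(2) by (auto simp: basic_nbhd_def)
  have "eventually (\<lambda>x. \<forall>j\<in>{..k}. \<bar>E (c p j) x - E (c p j) p\<bar> < 1 / Suc k) (nbhd_filter E c P q)"
  proof (rule eventually_ball_finite; clarsimp)
    fix j assume "j \<le> k"
    have "((\<lambda>x. \<bar>E (c p j) x - E (c p j) p\<bar>) \<longlongrightarrow> \<bar>E (c p j) q - E (c p j) p\<bar>) (nbhd_filter E c P q)"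
      by (intro tendsto_intros tends c_in assms(1) q(1))
    then show "eventually (\<lambda>x. \<bar>E (c p j) x - E (c p j) p\<bar> < 1 / (1 + real k)) (nbhd_filter E c P q)"
      by (rule order_tendstoD(2)) (use q(2)[OF \<open>j \<le> k\<close>] in simp)
  qed
  moreover have "eventually (\<lambda>x. x \<in> P) (nbhd_filter E c P q)"
    unfolding eventually_nbhd_filter by (auto simp: basic_nbhd_def)
  ultimately show ?thesis
    by eventually_elim (simp add: basic_nbhd_def)
qed

end

text \<open>Continuity on P follows from convergence along X as in the extension of maps into a
  regular space. A point q near p is approximated by some x in X that is still near p and has
  \<open>E i x\<close> close to \<open>E i q\<close>; each of the two distances costs half of the
  error.\<close>

lemma coordinate_system_from_dense:
  assumes "X \<subseteq> P" and c_in: "\<And>p n. p \<in> P \<Longrightarrow> c p n \<in> J"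
    and tends: "\<And>p i. p \<in> P \<Longrightarrow> i \<in> J \<Longrightarrow> (E i \<longlongrightarrow> E i p) (nbhd_filter E c X p)"
    and dense: "\<And>p k. p \<in> P \<Longrightarrow> basic_nbhd E c X p k \<noteq> {}"
  shows "coordinate_system P J E c"
proof
  fix p i assume p: "p \<in> P" and i: "i \<in> J"
  show "(E i \<longlongrightarrow> E i p) (nbhd_filter E c P p)"
  proof (rule tendstoI)
    fix e :: real assume "e > 0"
    then obtain k where k: "\<And>x. x \<in> basic_nbhd E c X p k \<Longrightarrow> dist (E i x) (E i p) < e / 2"
      using tendstoD[OF tends[OF p i], of "e / 2"] by (auto simp: eventually_nbhd_filter)
    have "dist (E i q) (E i p) < e" if q: "q \<in> basic_nbhd E c P p k" for q
    proof -
      have qP: "q \<in> P" and qk: "\<And>j. j \<le> k \<Longrightarrow> \<bar>E (c p j) q - E (c p j) p\<bar> < 1 / Suc k"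
        using q by (auto simp: basic_nbhd_def)
      have "eventually (\<lambda>x. \<forall>j\<in>{..k}. \<bar>E (c p j) x - E (c p j) p\<bar> < 1 / Suc k) (nbhd_filter E c X q)"
      proof (rule eventually_ball_finite; clarsimp)
        fix j assume "j \<le> k"
        have "((\<lambda>x. \<bar>E (c p j) x - E (c p j) p\<bar>) \<longlongrightarrow> \<bar>E (c p j) q - E (c p j) p\<bar>) (nbhd_filter E c X q)"
          by (intro tendsto_intros tends c_in p qP)
        then show "eventually (\<lambda>x. \<bar>E (c p j) x - E (c p j) p\<bar> < 1 / (1 + real k)) (nbhd_filter E c X q)"
          by (rule order_tendstoD(2)) (use qk[OF \<open>j \<le> k\<close>] in simp)
      qed
      moreover have "eventually (\<lambda>x. x \<in> X) (nbhd_filter E c X q)"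
        unfolding eventually_nbhd_filter by (auto simp: basic_nbhd_def)
      moreover have "eventually (\<lambda>x. dist (E i x) (E i q) < e / 2) (nbhd_filter E c X q)"
        using tendstoD[OF tends[OF qP i], of "e / 2"] \<open>e > 0\<close> by simp
      ultimately have "eventually (\<lambda>x. x \<in> basic_nbhd E c X p k \<and> dist (E i x) (E i q) < e / 2)
          (nbhd_filter E c X q)"
        by eventually_elim (simp add: basic_nbhd_def)
      then obtain x where "x \<in> basic_nbhd E c X p k" "dist (E i x) (E i q) < e / 2"
        using eventually_happens'[OF nbhd_filter_neq_bot[OF dense[OF qP]]] by blast
      then show ?thesis
        using k[of x] dist_triangle_half_r[of "E i x" "E i q" e "E i p"] by (simp add: dist_commute)
    qed
    then show "\<forall>\<^sub>F q in nbhd_filter E c P p. dist (E i q) (E i p) < e"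
      unfolding eventually_nbhd_filter by blast
  qed
qed (rule c_in)

text \<open>The data for adjoining to \<open>P\<close> one limit point of a subsequence of \<open>s\<close>: \<open>v\<close> lists its old
  coordinates, and \<open>h\<close> is a new coordinate, equal to 1 exactly at the new point, whose
  superlevel sets form a neighbourhood base there.\<close>

definition limit_data ::
    "('j \<Rightarrow> 'p \<Rightarrow> real) \<Rightarrow> ('p \<Rightarrow> nat \<Rightarrow> 'j) \<Rightarrow> 'p set \<Rightarrow> 'j set \<Rightarrow> (nat \<Rightarrow> 'p) \<Rightarrow>
      ('j \<Rightarrow> real) \<Rightarrow> ('p \<Rightarrow> real) \<Rightarrow> bool" where
  "limit_data E c P J s v h \<longleftrightarrow>
     (\<forall>i\<in>J. v i \<in> {0..1}) \<and>
     (\<forall>q\<in>P. 0 \<le> h q \<and> h q < 1) \<and>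
     (\<forall>p\<in>P. (h \<longlongrightarrow> h p) (nbhd_filter E c P p)) \<and>
     (\<forall>i\<in>J. \<forall>e>0. \<exists>d>0. \<forall>q\<in>P. h q > 1 - d \<longrightarrow> \<bar>E i q - v i\<bar> < e) \<and>
     (\<forall>d>0. \<exists>n. h (s n) > 1 - d)"

text \<open>Without an accumulation point of \<open>s\<close>, no point of \<open>P\<close> has the
  limit coordinates \<open>v\<close>. Hence each x is told apart from \<open>v\<close> by some
  coordinate, and since the sets \<open>U n\<close> shrink towards \<open>v\<close> in that
  coordinate, only finitely many of them come near x. Continuity of \<open>h\<close> and
  \<open>h q < 1\<close> rest on this local finiteness.\<close>

lemma (in coordinate_system) obtain_limit_data:
  fixes s :: "nat \<Rightarrow> 'p"
  assumes b: "bounding_number =o continuum" and F: "simple_P_c_point F"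
    and J: "|J| <o |UNIV :: real set|" and bnd: "\<And>i p. i \<in> J \<Longrightarrow> p \<in> P \<Longrightarrow> E i p \<in> {0..1}"
    and sP: "\<And>n. s n \<in> P"
    and no_acc: "\<And>p. p \<in> P \<Longrightarrow> \<exists>k. finite {n. s n \<in> basic_nbhd E c P p k}"
  shows "\<exists>v h. limit_data E c P J s v h"
proof -
  let ?N = "basic_nbhd E c P" and ?F = "nbhd_filter E c P"
  have "E i (s n) \<in> {0..1}" if "i \<in> J" for i n
    using bnd that sP by blast
  then obtain v r where r: "strict_mono (r :: nat \<Rightarrow> nat)" and v: "\<And>i. i \<in> J \<Longrightarrow> v i \<in> {0..1}"
    and lim: "\<And>i. i \<in> J \<Longrightarrow> (\<lambda>n. E i (s (r n))) \<longlonglongrightarrow> v i"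
    using simultaneous_convergent_subsequence[OF b F J, of "\<lambda>i n. E i (s n)"] by metis
  define t where "t n = s (r n)" for n
  have tP: "t n \<in> P" for n
    by (simp add: t_def sP)
  have tlim: "(\<lambda>n. E i (t n)) \<longlonglongrightarrow> v i" if "i \<in> J" for i
    using lim[OF that] by (simp add: t_def)
  have t_no_acc: "\<exists>k. finite {n. t n \<in> ?N p k}" if p: "p \<in> P" for p
  proof -
    obtain k where "finite {n. s n \<in> ?N p k}"
      using no_acc[OF p] by blast
    then have "finite (r -` {n. s n \<in> ?N p k})"
      by (rule finite_vimageI[OF _ strict_mono_imp_inj_on[OF r]])
    then show ?thesis
      by (auto simp: t_def vimage_def)
  qed
  \<comment> \<open>Each basic neighbourhood tests finitely many coordinates, so one of a point with
    coordinates \<open>v\<close> would contain almost all \<open>t n\<close>.\<close>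
  have diff: "\<exists>i\<in>J. E i x \<noteq> v i" if x: "x \<in> P" for x
  proof (rule ccontr)
    assume "\<not> ?thesis"
    then have eq: "\<And>i. i \<in> J \<Longrightarrow> E i x = v i"
      by blast
    obtain k where k: "finite {n. t n \<in> ?N x k}"
      using t_no_acc[OF x] by blast
    have "\<forall>\<^sub>F n in sequentially. \<forall>j\<in>{..k}. \<bar>E (c x j) (t n) - E (c x j) x\<bar> < 1 / Suc k"
    proof (rule eventually_ball_finite; clarsimp)
      fix j
      show "\<forall>\<^sub>F n in sequentially. \<bar>E (c x j) (t n) - E (c x j) x\<bar> < 1 / (1 + real k)"
        using tendstoD[OF tlim[OF c_in[OF x, of j]], of "1 / (1 + real k)"] eq[OF c_in[OF x, of j]]
        by (simp add: dist_real_def)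
    qed
    then have "\<forall>\<^sub>F n in sequentially. t n \<in> ?N x k"
      by eventually_elim (simp add: basic_nbhd_def tP)
    then have "finite {n. t n \<notin> ?N x k}"
      by (simp add: cofinite_eq_sequentially[symmetric] eventually_cofinite)
    with k have "finite ({n. t n \<in> ?N x k} \<union> {n. t n \<notin> ?N x k})"
      by blast
    moreover have "{n. t n \<in> ?N x k} \<union> {n. t n \<notin> ?N x k} = UNIV"
      by blast
    ultimately show False
      by simp
  qed
  have "\<exists>k. \<forall>q\<in>?N (t n) k. \<bar>E i q - E i (t n)\<bar> < 1 / Suc n" if "i \<in> J" for i n
    using tendstoD[OF tends[OF tP[of n] that], of "1 / Suc n"]
    by (simp add: eventually_nbhd_filter dist_real_def)
  then obtain osc where osc: "\<And>i n q. i \<in> J \<Longrightarrow> q \<in> ?N (t n) (osc i n) \<Longrightarrow> \<bar>E i q - E i (t n)\<bar> < 1 / Suc n"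
    by metis
  have "|osc ` J| <o |UNIV :: real set|"
    using J card_of_image ordLeq_ordLess_trans by blast
  \<comment> \<open>One g serves all coordinates: for each i, the neighbourhood of index
    \<open>g n\<close> is small enough for all but finitely many n.\<close>
  from eventually_bounded_family[OF b this] obtain g
    where g: "\<And>i. i \<in> J \<Longrightarrow> \<forall>\<^sub>\<infinity>n. osc i n \<le> g n"
    by blast
  define U where "U n = ?N (t n) (g n)" for n
  have near: "\<exists>m. \<forall>n\<ge>m. \<forall>q\<in>U n. \<bar>E i q - v i\<bar> < e" if i: "i \<in> J" and "e > 0" for i e
  proof -
    have "(\<lambda>n. 1 / real (Suc n)) \<longlonglongrightarrow> 0"
      using LIMSEQ_inverse_real_of_nat by (simp add: inverse_eq_divide)
    then have "\<forall>\<^sub>F n in sequentially. 1 / real (Suc n) < e / 2"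
      by (rule order_tendstoD(2)) (use \<open>e > 0\<close> in simp)
    moreover have "\<forall>\<^sub>F n in sequentially. dist (E i (t n)) (v i) < e / 2"
      by (rule tendstoD[OF tlim[OF i]]) (use \<open>e > 0\<close> in simp)
    moreover have "\<forall>\<^sub>F n in sequentially. osc i n \<le> g n"
      using g[OF i] by (simp add: cofinite_eq_sequentially)
    ultimately have "\<forall>\<^sub>F n in sequentially. \<forall>q\<in>U n. \<bar>E i q - v i\<bar> < e"
    proof eventually_elim
      case (elim n)
      show ?case
      proof
        fix q assume "q \<in> U n"
        then have "q \<in> ?N (t n) (osc i n)"
          unfolding U_def by (rule subsetD[OF basic_nbhd_antimono[OF elim(3)]])
        from osc[OF i this] elim(1,2) show "\<bar>E i q - v i\<bar> < e"
          unfolding dist_real_def by linarith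
      qed
    qed
    then show ?thesis
      by (simp add: eventually_sequentially)
  qed
  have locfin: "\<exists>m. eventually (\<lambda>q. \<forall>n\<ge>m. q \<notin> U n) (?F x)" if x: "x \<in> P" for x
  proof -
    obtain i where i: "i \<in> J" "E i x \<noteq> v i"
      using diff[OF x] by blast
    \<comment> \<open>Half the distance, so that q cannot be within e of both x and the limit in
      coordinate i.\<close>
    define e where "e = \<bar>E i x - v i\<bar> / 2"
    have "e > 0"
      using i(2) by (simp add: e_def)
    obtain m where m: "\<And>n q. n \<ge> m \<Longrightarrow> q \<in> U n \<Longrightarrow> \<bar>E i q - v i\<bar> < e"
      using near[OF i(1) \<open>e > 0\<close>] by blast
    have "eventually (\<lambda>q. dist (E i q) (E i x) < e) (?F x)"
      by (rule tendstoD[OF tends[OF x i(1)] \<open>e > 0\<close>])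
    then have "eventually (\<lambda>q. \<forall>n\<ge>m. q \<notin> U n) (?F x)"
    proof eventually_elim
      case (elim q)
      then show ?case
        using m[of _ q] by (force simp: dist_real_def e_def abs_if split: if_splits)
    qed
    then show ?thesis
      by blast
  qed
  \<comment> \<open>The factor \<open>Suc (g n)\<close> is the inverse of the radius of
    \<open>U n\<close>: where the bump is positive, every summand is below that radius.\<close>
  define \<phi> where "\<phi> n q = max 0 (1 - real (Suc (g n)) *
      (\<Sum>j\<le>g n. \<bar>E (c (t n) j) q - E (c (t n) j) (t n)\<bar>))" for n q
  have \<phi>_cont: "(\<phi> n \<longlongrightarrow> \<phi> n p) (?F p)" if "p \<in> P" for n p
    unfolding \<phi>_def by (intro tendsto_intros tends c_in that tP)
  have \<phi>_le: "0 \<le> \<phi> n q \<and> \<phi> n q \<le> 1" for n q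
    by (simp add: \<phi>_def sum_nonneg)
  have \<phi>_t: "\<phi> n (t n) = 1" for n
    by (simp add: \<phi>_def)
  have \<phi>_supp: "q \<in> U n" if "q \<in> P" "\<phi> n q > 0" for n q
  proof -
    have less: "real (Suc (g n)) * (\<Sum>j\<le>g n. \<bar>E (c (t n) j) q - E (c (t n) j) (t n)\<bar>) < 1"
      using that(2) by (auto simp: \<phi>_def max_def split: if_splits)
    have "\<bar>E (c (t n) j) q - E (c (t n) j) (t n)\<bar> < 1 / Suc (g n)" if "j \<le> g n" for j
    proof -
      have "\<bar>E (c (t n) j) q - E (c (t n) j) (t n)\<bar> \<le>
          (\<Sum>j\<le>g n. \<bar>E (c (t n) j) q - E (c (t n) j) (t n)\<bar>)"
        using that by (intro member_le_sum) auto
      also have "\<dots> < 1 / Suc (g n)"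
        using less by (simp add: field_simps)
      finally show ?thesis .
    qed
    then show ?thesis
      using that(1) by (simp add: U_def basic_nbhd_def)
  qed
  \<comment> \<open>Heights increasing to 1 without reaching it. They let \<open>h\<close> approach
    1 along \<open>t\<close>, and a value above \<open>a m\<close> reveals that it comes from a bump
    of index beyond m.\<close>
  define a where "a n = real (Suc n) / real (Suc (Suc n))" for n
  have a_less: "a n < a m \<longleftrightarrow> n < m" for n m
    by (auto simp: a_def divide_simps algebra_simps)
  have a_bounds: "0 \<le> a n" "a n < 1" for n
    by (simp_all add: a_def)
  have a_le: "a n \<le> a m" if "n \<le> m" for n m
    using a_less[of m n] that by linarith
  define \<psi> where "\<psi> n q = \<phi> n q * a n" for n q
  have \<psi>_bounds: "0 \<le> \<psi> n q" "\<psi> n q \<le> a n" for n q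
    using \<phi>_le[of n q] a_bounds(1)[of n] by (auto simp: \<psi>_def mult_left_le_one_le)
  have \<psi>_cont: "(\<psi> n \<longlongrightarrow> \<psi> n p) (?F p)" if "p \<in> P" for n p
    unfolding \<psi>_def by (intro tendsto_intros \<phi>_cont that)
  have \<psi>_zero: "\<psi> n q = 0" if "q \<in> P" "q \<notin> U n" for n q
    using \<phi>_supp[OF that(1)] that(2) \<phi>_le[of n q] by (force simp: \<psi>_def)
  \<comment> \<open>A supremum rather than a sum, because the sets \<open>U n\<close> may overlap
    and the heights must not add up.\<close>
  define h where "h q = (SUP n. \<psi> n q)" for q
  have bdd: "bdd_above (range (\<lambda>n. \<psi> n q))" for q
    using \<psi>_bounds a_bounds by (intro bdd_aboveI[of _ 1]) (force intro: order_trans less_imp_le)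
  have \<psi>_le_h: "\<psi> n q \<le> h q" for n q
    unfolding h_def by (rule cSUP_upper[OF _ bdd]) simp
  have h_le: "h q \<le> z" if "\<And>n. \<psi> n q \<le> z" for q z
    unfolding h_def by (rule cSUP_least) (use that in auto)
  have h_bounds: "0 \<le> h q \<and> h q < 1" if q: "q \<in> P" for q
  proof -
    obtain m where m: "\<And>n. n \<ge> m \<Longrightarrow> q \<notin> U n"
      using locfin[OF q] eventually_nbhd_filter_self[OF _ q] by blast
    have "\<psi> n q \<le> a m" for n
    proof (cases "n \<ge> m")
      case True
      then show ?thesis
        using \<psi>_zero[OF q m] a_bounds(1) by simp
    next
      case False
      then show ?thesis
        using \<psi>_bounds(2)[of n q] a_le[of n m] by simp
    qed
    then have "h q \<le> a m"
      by (rule h_le)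
    then show ?thesis
      using a_bounds(2)[of m] \<psi>_bounds(1)[of 0 q] \<psi>_le_h[of 0 q] by linarith
  qed
  have h_cont: "(h \<longlongrightarrow> h p) (?F p)" if p: "p \<in> P" for p
  proof (rule tendstoI)
    fix e :: real assume "e > 0"
    obtain m where m: "eventually (\<lambda>q. \<forall>n\<ge>m. q \<notin> U n) (?F p)"
      using locfin[OF p] by blast
    have mp: "\<And>n. n \<ge> m \<Longrightarrow> p \<notin> U n"
      using eventually_nbhd_filter_self[OF m p] by blast
    have "eventually (\<lambda>q. \<forall>n\<in>{..<m}. dist (\<psi> n q) (\<psi> n p) < e / 2) (?F p)"
      using \<open>e > 0\<close> by (intro eventually_ball_finite ballI tendstoD[OF \<psi>_cont[OF p]]) auto
    moreover have "eventually (\<lambda>q. q \<in> P) (?F p)"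
      unfolding eventually_nbhd_filter by (auto simp: basic_nbhd_def)
    ultimately show "eventually (\<lambda>q. dist (h q) (h p) < e) (?F p)"
      using m
    proof eventually_elim
      case (elim q)
      have close: "\<bar>\<psi> n q - \<psi> n p\<bar> \<le> e / 2" for n
      proof (cases "n < m")
        case True
        then show ?thesis
          using elim(1) by (force simp: dist_real_def)
      next
        case False
        then show ?thesis
          using \<psi>_zero[OF elim(2)] \<psi>_zero[OF p] elim(3) mp \<open>e > 0\<close> by simp
      qed
      have "h q \<le> h p + e / 2"
      proof (rule h_le)
        fix n
        show "\<psi> n q \<le> h p + e / 2"
          using close[of n] \<psi>_le_h[of n p] by linarith
      qed
      moreover have "h p \<le> h q + e / 2"
      proof (rule h_le)
        fix n
        show "\<psi> n p \<le> h q + e / 2"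
          using close[of n] \<psi>_le_h[of n q] by linarith
      qed
      ultimately show ?case
        using \<open>e > 0\<close> by (simp add: dist_real_def)
    qed
  qed
  have h_nbhds: "\<exists>d>0. \<forall>q\<in>P. h q > 1 - d \<longrightarrow> \<bar>E i q - v i\<bar> < e" if "i \<in> J" "e > 0" for i e
  proof -
    obtain m where m: "\<And>n q. n \<ge> m \<Longrightarrow> q \<in> U n \<Longrightarrow> \<bar>E i q - v i\<bar> < e"
      using near[OF \<open>i \<in> J\<close> \<open>e > 0\<close>] by blast
    \<comment> \<open>The threshold is \<open>a m\<close>, written as 1 - d with d = 1 -
      \<open>a m\<close>. A value above it is due to a bump beyond m, whose support is already
      e-close to \<open>v i\<close>.\<close>
    have "\<bar>E i q - v i\<bar> < e" if q: "q \<in> P" "h q > 1 - (1 - a m)" for q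
    proof -
      have "\<not> (\<forall>n. \<psi> n q \<le> a m)"
        using h_le[of q "a m"] q(2) by auto
      then obtain n where n: "\<psi> n q > a m"
        by (auto simp: not_le)
      have "m < n"
        using n \<psi>_bounds(2)[of n q] a_less[of m n] by linarith
      moreover have "\<psi> n q \<noteq> 0"
        using n a_bounds(1)[of m] by linarith
      ultimately show ?thesis
        using m[of n q] \<psi>_zero[OF q(1)] by fastforce
    qed
    then show ?thesis
      using a_bounds(2)[of m] by (intro exI[of _ "1 - a m"]) auto
  qed
  have h_sup: "\<exists>n. h (s n) > 1 - d" if "d > 0" for d
  proof -
    obtain n where n: "inverse (real (Suc n)) < d"
      using reals_Archimedean \<open>d > 0\<close> by blast
    have "1 - inverse (real (Suc n)) < a n"
      by (simp add: a_def divide_simps) (simp add: algebra_simps)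
    also have "a n = \<psi> n (t n)"
      by (simp add: \<psi>_def \<phi>_t)
    also have "\<dots> \<le> h (t n)"
      by (rule \<psi>_le_h)
    finally show ?thesis
      using n by (intro exI[of _ "r n"]) (simp add: t_def)
  qed
  show ?thesis
    unfolding limit_data_def
    by (intro exI[of _ v] exI[of _ h] conjI ballI allI impI v h_bounds h_cont h_nbhds h_sup) auto
qed

section \<open>Transfinite extensions\<close>

text \<open>A transfinite construction is a partial function \<open>f\<close> on the stages; at a stage \<open>\<beta>\<close> where
  it is defined, both the point \<open>Inr \<beta>\<close> and the coordinate \<open>Inr \<beta>\<close> are adjoined. The value of
  the coordinate \<open>Inr \<gamma>\<close> at the point \<open>Inr \<beta>\<close> is part of the data of the later stage.\<close>

type_synonym ('x, 'i, 'k) construction =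
  "'k \<Rightarrow> (('i + 'k \<Rightarrow> real) \<times> ('x + 'k \<Rightarrow> real)) option"

locale transfinite_extension =
  fixes R :: "'k rel" and X0 :: "'x set" and I0 :: "'i set"
    and E0 :: "'i \<Rightarrow> 'x \<Rightarrow> real" and c0 :: "'x \<Rightarrow> nat \<Rightarrow> 'i"
  assumes wf_R: "wf R" and trans_R: "trans R" and total_R: "total R"
    and base: "coordinate_system X0 I0 E0 c0"
    and E0_bounds: "i \<in> I0 \<Longrightarrow> x \<in> X0 \<Longrightarrow> E0 i x \<in> {0..1}"
begin

text \<open>What the construction knows just before stage \<alpha>. Conditions on stage \<alpha> are
  phrased through it, which makes recursion along R legitimate.\<close>

definition cut :: "('x, 'i, 'k) construction \<Rightarrow> 'k \<Rightarrow> ('x, 'i, 'k) construction" where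
  "cut f \<alpha> \<beta> = (if (\<beta>, \<alpha>) \<in> R then f \<beta> else None)"

definition pts :: "('x, 'i, 'k) construction \<Rightarrow> ('x + 'k) set" where
  "pts f = Inl ` X0 \<union> Inr ` dom f"

definition idx :: "('x, 'i, 'k) construction \<Rightarrow> ('i + 'k) set" where
  "idx f = Inl ` I0 \<union> Inr ` dom f"

definition coord :: "('x, 'i, 'k) construction \<Rightarrow> 'i + 'k \<Rightarrow> 'x + 'k \<Rightarrow> real" where
  "coord f i p = (case p of
     Inl x \<Rightarrow> (case i of Inl i' \<Rightarrow> E0 i' x | Inr \<gamma> \<Rightarrow> snd (the (f \<gamma>)) p)
   | Inr \<beta> \<Rightarrow> (case i of Inl i' \<Rightarrow> fst (the (f \<beta>)) i
       | Inr \<gamma> \<Rightarrow> if \<gamma> = \<beta> then 1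
           else if (\<gamma>, \<beta>) \<in> R then fst (the (f \<beta>)) i else snd (the (f \<gamma>)) p))"

text \<open>The sequence is constant at an adjoined point, since its own coordinate suffices there.
  It does not depend on the construction, so later stages never change the base chosen at a
  point.\<close>

definition nbhd_coords :: "'x + 'k \<Rightarrow> nat \<Rightarrow> 'i + 'k" where
  "nbhd_coords p n = (case p of Inl x \<Rightarrow> Inl (c0 x n) | Inr \<beta> \<Rightarrow> Inr \<beta>)"

definition valid_stage ::
    "('k \<Rightarrow> nat \<Rightarrow> 'x + 'k) \<Rightarrow> ('x, 'i, 'k) construction \<Rightarrow> 'k \<Rightarrow> bool" where
  "valid_stage e f \<beta> \<longleftrightarrow> (\<forall>v h. f \<beta> = Some (v, h) \<longrightarrow>
     limit_data (coord (cut f \<beta>)) nbhd_coords (pts (cut f \<beta>)) (idx (cut f \<beta>)) (e \<beta>) v h)"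

text \<open>Density refers to the original points and not to the preceding stage, so that nothing
  has to be glued together at limit stages.\<close>

definition dense_system :: "('x, 'i, 'k) construction \<Rightarrow> bool" where
  "dense_system f \<longleftrightarrow> coordinate_system (pts f) (idx f) (coord f) nbhd_coords \<and>
     (\<forall>p\<in>pts f. \<forall>k. basic_nbhd (coord f) nbhd_coords (Inl ` X0) p k \<noteq> {})"

section \<open>Restriction of a construction to earlier stages\<close>

lemma not_R_refl: "(\<beta>, \<beta>) \<notin> R"
  using wf_R by (simp add: wf_irrefl)

lemma R_asym: "(\<beta>, \<gamma>) \<in> R \<Longrightarrow> (\<gamma>, \<beta>) \<notin> R"
  using wf_R by (rule wf_not_sym)

lemma cut_cut: "(\<beta>, \<alpha>) \<in> R \<Longrightarrow> cut (cut f \<alpha>) \<beta> = cut f \<beta>"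
  using trans_R by (auto simp: cut_def fun_eq_iff dest: transD)

lemma pts_cut_subset: "pts (cut f \<alpha>) \<subseteq> pts f"
  by (auto simp: pts_def cut_def dom_def split: if_splits)

lemma Inl_in_pts [simp]: "Inl x \<in> pts f \<longleftrightarrow> x \<in> X0"
  by (auto simp: pts_def)

lemma Inl_in_idx [simp]: "Inl i \<in> idx f \<longleftrightarrow> i \<in> I0"
  by (auto simp: idx_def)

lemma Inr_in_pts [simp]: "Inr \<beta> \<in> pts f \<longleftrightarrow> \<beta> \<in> dom f"
  by (auto simp: pts_def)

lemma Inr_in_idx [simp]: "Inr \<beta> \<in> idx f \<longleftrightarrow> \<beta> \<in> dom f"
  by (auto simp: idx_def)

lemma in_dom_cut [simp]: "\<gamma> \<in> dom (cut f \<beta>) \<longleftrightarrow> (\<gamma>, \<beta>) \<in> R \<and> \<gamma> \<in> dom f"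
  by (simp add: cut_def domIff)

lemma R_cases: "\<beta> = \<gamma> \<or> (\<beta>, \<gamma>) \<in> R \<or> (\<gamma>, \<beta>) \<in> R"
  using total_R by (auto simp: total_on_def)

text \<open>The value of a coordinate at a point is governed by whichever of the two was adjoined
  later; comparability of stages leaves these cases.\<close>

lemma coord_cases [consumes 2, case_names base old new self]:
  assumes "i \<in> idx f" "p \<in> pts f"
  obtains (base) j x where "i = Inl j" "p = Inl x" "j \<in> I0" "x \<in> X0"
    | (old) \<beta> where "p = Inr \<beta>" "\<beta> \<in> dom f" "i \<in> idx (cut f \<beta>)"
    | (new) \<gamma> where "i = Inr \<gamma>" "\<gamma> \<in> dom f" "p \<in> pts (cut f \<gamma>)"
    | (self) \<gamma> where "i = Inr \<gamma>" "p = Inr \<gamma>"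
proof (cases i)
  case (Inl j)
  then show thesis
    using assms that(1,2) by (cases p) simp_all
next
  case (Inr \<gamma>)
  then show thesis
    using assms that(2,3,4) R_cases[of \<gamma>] by (cases p) (simp_all, metis)
qed

lemma base_in_pts: "Inl ` X0 \<subseteq> pts f"
  by (simp add: pts_def)

lemma nbhd_coords_in: "p \<in> pts f \<Longrightarrow> nbhd_coords p n \<in> idx f"
  using coordinate_system.c_in[OF base] by (auto simp: pts_def idx_def nbhd_coords_def)

lemma coord_cut: "i \<in> idx (cut f \<alpha>) \<Longrightarrow> p \<in> pts (cut f \<alpha>) \<Longrightarrow> coord (cut f \<alpha>) i p = coord f i p"
  by (auto simp: idx_def pts_def coord_def cut_def dom_def split: if_splits)

lemma basic_nbhd_cut:
  "p \<in> pts (cut f \<alpha>) \<Longrightarrow> P \<subseteq> pts (cut f \<alpha>) \<Longrightarrow>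
    basic_nbhd (coord (cut f \<alpha>)) nbhd_coords P p k = basic_nbhd (coord f) nbhd_coords P p k"
  unfolding basic_nbhd_def by (auto simp: coord_cut nbhd_coords_in)

lemma nbhd_filter_cut:
  "p \<in> pts (cut f \<alpha>) \<Longrightarrow> P \<subseteq> pts (cut f \<alpha>) \<Longrightarrow>
    nbhd_filter (coord (cut f \<alpha>)) nbhd_coords P p = nbhd_filter (coord f) nbhd_coords P p"
  by (simp add: nbhd_filter_def basic_nbhd_cut)

context
  fixes e :: "'k \<Rightarrow> nat \<Rightarrow> 'x + 'k" and f :: "('x, 'i, 'k) construction" and \<beta> :: 'k
  assumes valid: "valid_stage e f \<beta>" and dom: "\<beta> \<in> dom f"
begin

text \<open>The conditions in \<open>valid_stage\<close> are about the construction before \<beta>.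
  Restriction changes neither coordinates nor traces of neighbourhoods, so they can be read in the
  coordinates of the whole construction.\<close>

lemma stage_data:
  shows stage_coord_bounds: "i \<in> idx (cut f \<beta>) \<Longrightarrow> coord f i (Inr \<beta>) \<in> {0..1}"
    and stage_new_coord_bounds:
      "q \<in> pts (cut f \<beta>) \<Longrightarrow> 0 \<le> coord f (Inr \<beta>) q \<and> coord f (Inr \<beta>) q < 1"
    and stage_new_coord_tends: "p \<in> pts (cut f \<beta>) \<Longrightarrow>
      (coord f (Inr \<beta>) \<longlongrightarrow> coord f (Inr \<beta>) p) (nbhd_filter (coord f) nbhd_coords (pts (cut f \<beta>)) p)"
    and stage_coord_tends: "i \<in> idx (cut f \<beta>) \<Longrightarrow> \<epsilon> > 0 \<Longrightarrow> \<exists>d>0. \<forall>q\<in>pts (cut f \<beta>).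
      coord f (Inr \<beta>) q > 1 - d \<longrightarrow> \<bar>coord f i q - coord f i (Inr \<beta>)\<bar> < \<epsilon>"
    and stage_cluster: "range (e \<beta>) \<subseteq> pts (cut f \<beta>) \<Longrightarrow> d > 0 \<Longrightarrow>
      \<exists>n. coord f (Inr \<beta>) (e \<beta> n) > 1 - d"
proof -
  obtain v h where f: "f \<beta> = Some (v, h)"
    using dom by auto
  have data: "limit_data (coord (cut f \<beta>)) nbhd_coords (pts (cut f \<beta>)) (idx (cut f \<beta>)) (e \<beta>) v h"
    using valid f unfolding valid_stage_def by blast
  have v: "coord f i (Inr \<beta>) = v i" if "i \<in> idx (cut f \<beta>)" for i
    using that not_R_refl by (auto simp: idx_def coord_def cut_def dom_def f split: if_splits)
  have h: "coord f (Inr \<beta>) q = h q" if "q \<in> pts (cut f \<beta>)" for q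
    using that not_R_refl R_asym by (auto simp: pts_def coord_def cut_def dom_def f split: if_splits)
  show "coord f i (Inr \<beta>) \<in> {0..1}" if "i \<in> idx (cut f \<beta>)"
    using data that v[OF that] unfolding limit_data_def by simp
  show "0 \<le> coord f (Inr \<beta>) q \<and> coord f (Inr \<beta>) q < 1" if "q \<in> pts (cut f \<beta>)"
    using data that h[OF that] unfolding limit_data_def by simp
  show "(coord f (Inr \<beta>) \<longlongrightarrow> coord f (Inr \<beta>) p) (nbhd_filter (coord f) nbhd_coords (pts (cut f \<beta>)) p)"
    if p: "p \<in> pts (cut f \<beta>)"
  proof -
    have "(h \<longlongrightarrow> h p) (nbhd_filter (coord f) nbhd_coords (pts (cut f \<beta>)) p)"
      using data p unfolding limit_data_def by (simp add: nbhd_filter_cut)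
    moreover have "eventually (\<lambda>q. h q = coord f (Inr \<beta>) q)
        (nbhd_filter (coord f) nbhd_coords (pts (cut f \<beta>)) p)"
      using h basic_nbhd_subset unfolding eventually_nbhd_filter by fastforce
    ultimately show ?thesis
      unfolding h[OF p] by (rule Lim_transform_eventually)
  qed
  show "\<exists>d>0. \<forall>q\<in>pts (cut f \<beta>). coord f (Inr \<beta>) q > 1 - d \<longrightarrow>
      \<bar>coord f i q - coord f i (Inr \<beta>)\<bar> < \<epsilon>" if i: "i \<in> idx (cut f \<beta>)" and "\<epsilon> > 0"
  proof -
    obtain d where "d > 0"
      "\<forall>q\<in>pts (cut f \<beta>). h q > 1 - d \<longrightarrow> \<bar>coord (cut f \<beta>) i q - v i\<bar> < \<epsilon>"
      using data i \<open>\<epsilon> > 0\<close> unfolding limit_data_def by blast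
    then show ?thesis
      using h v[OF i] coord_cut[OF i] by (intro exI[of _ d]) auto
  qed
  show "\<exists>n. coord f (Inr \<beta>) (e \<beta> n) > 1 - d" if ran: "range (e \<beta>) \<subseteq> pts (cut f \<beta>)" and "d > 0"
  proof -
    obtain n where "h (e \<beta> n) > 1 - d"
      using data \<open>d > 0\<close> unfolding limit_data_def by blast
    then show ?thesis
      using h[OF subsetD[OF ran rangeI], of n] by (intro exI[of _ n]) simp
  qed
qed

end

section \<open>Continuity, density and separation along the stages\<close>

definition stages_ok :: "('k \<Rightarrow> nat \<Rightarrow> 'x + 'k) \<Rightarrow> ('x, 'i, 'k) construction \<Rightarrow> bool" where
  "stages_ok e f \<longleftrightarrow> (\<forall>\<beta>\<in>dom f. valid_stage e f \<beta> \<and> range (e \<beta>) \<subseteq> pts (cut f \<beta>))"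

lemma stages_ok_cut:
  assumes "stages_ok e f"
  shows "stages_ok e (cut f \<alpha>)"
  unfolding stages_ok_def
proof
  fix \<beta> assume "\<beta> \<in> dom (cut f \<alpha>)"
  then have "(\<beta>, \<alpha>) \<in> R" "\<beta> \<in> dom f"
    by (auto simp: cut_def dom_def split: if_splits)
  then show "valid_stage e (cut f \<alpha>) \<beta> \<and> range (e \<beta>) \<subseteq> pts (cut (cut f \<alpha>) \<beta>)"
    using assms unfolding stages_ok_def valid_stage_def by (simp add: cut_cut) (simp add: cut_def)
qed

text \<open>By \<open>coordinate_system_from_dense\<close> it is enough to check limits along
  \<open>X0\<close>, which is done for each case of \<open>coord_cases\<close>. The hypothesis on
  earlier stages enters through density: a new point is approached by earlier points, and these by
  points of \<open>X0\<close>.\<close>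

lemma dense_system_step:
  assumes ok: "stages_ok e f" and prev: "\<And>\<beta>. \<beta> \<in> dom f \<Longrightarrow> dense_system (cut f \<beta>)"
  shows "dense_system f"
proof -
  let ?X = "Inl ` X0 :: ('x + 'k) set" and ?E = "coord f" and ?c = nbhd_coords
  have valid: "valid_stage e f \<beta>" and ran: "range (e \<beta>) \<subseteq> pts (cut f \<beta>)" if "\<beta> \<in> dom f" for \<beta>
    using ok that unfolding stages_ok_def by blast+
  have tends: "(?E i \<longlongrightarrow> ?E i p) (nbhd_filter ?E ?c ?X p)" if p: "p \<in> pts f" and i: "i \<in> idx f" for p i
  proof -
    have base_tends: "(?E (Inl j) \<longlongrightarrow> ?E (Inl j) (Inl x)) (nbhd_filter ?E ?c ?X (Inl x))"
      if x: "x \<in> X0" and j: "j \<in> I0" for x j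
    proof (rule tendstoI)
      fix \<epsilon> :: real assume "\<epsilon> > 0"
      then obtain k where "\<And>y. y \<in> basic_nbhd E0 c0 X0 x k \<Longrightarrow> dist (E0 j y) (E0 j x) < \<epsilon>"
        using tendstoD[OF coordinate_system.tends[OF base x j]] unfolding eventually_nbhd_filter by meson
      then show "eventually (\<lambda>q. dist (?E (Inl j) q) (?E (Inl j) (Inl x)) < \<epsilon>) (nbhd_filter ?E ?c ?X (Inl x))"
        unfolding eventually_nbhd_filter
        by (intro exI[of _ k]) (auto simp: basic_nbhd_def nbhd_coords_def coord_def)
    qed
    have old_tends: "(?E i \<longlongrightarrow> ?E i (Inr \<beta>)) (nbhd_filter ?E ?c ?X (Inr \<beta>))"
      if \<beta>: "\<beta> \<in> dom f" and i: "i \<in> idx (cut f \<beta>)" for \<beta> i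
    proof (rule tendstoI)
      fix \<epsilon> :: real assume "\<epsilon> > 0"
      from stage_coord_tends[OF valid[OF \<beta>] \<beta> i this]
      obtain d where d: "d > 0"
        "\<And>q. q \<in> pts (cut f \<beta>) \<Longrightarrow> ?E (Inr \<beta>) q > 1 - d \<Longrightarrow> \<bar>?E i q - ?E i (Inr \<beta>)\<bar> < \<epsilon>"
        by blast
      obtain k where k: "inverse (real (Suc k)) < d"
        using reals_Archimedean \<open>d > 0\<close> by blast
      have "dist (?E i q) (?E i (Inr \<beta>)) < \<epsilon>" if q: "q \<in> basic_nbhd ?E ?c ?X (Inr \<beta>) k" for q
      proof -
        have "q \<in> ?X" "\<bar>?E (Inr \<beta>) q - 1\<bar> < inverse (Suc k)"
          using q by (auto simp: basic_nbhd_def nbhd_coords_def coord_def inverse_eq_divide)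
        then show ?thesis
          using d(2)[of q] k base_in_pts unfolding dist_real_def by (smt (verit) subsetD)
      qed
      then show "eventually (\<lambda>q. dist (?E i q) (?E i (Inr \<beta>)) < \<epsilon>) (nbhd_filter ?E ?c ?X (Inr \<beta>))"
        unfolding eventually_nbhd_filter by blast
    qed
    \<comment> \<open>The stage provides convergence along all earlier points, and the trace of the
      filter on \<open>X0\<close> is finer.\<close>
    have new_tends: "(?E (Inr \<gamma>) \<longlongrightarrow> ?E (Inr \<gamma>) p) (nbhd_filter ?E ?c ?X p)"
      if \<gamma>: "\<gamma> \<in> dom f" and p: "p \<in> pts (cut f \<gamma>)" for \<gamma> p
      using stage_new_coord_tends[OF valid[OF \<gamma>] \<gamma> p] nbhd_filter_mono[OF base_in_pts]
      by (rule tendsto_mono[rotated])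
    have self_tends: "(?E (Inr \<gamma>) \<longlongrightarrow> ?E (Inr \<gamma>) (Inr \<gamma>)) (nbhd_filter ?E ?c ?X (Inr \<gamma>))" for \<gamma>
    proof (rule tendstoI)
      fix \<epsilon> :: real assume "\<epsilon> > 0"
      then obtain k where "inverse (real (Suc k)) < \<epsilon>"
        using reals_Archimedean by blast
      then show "eventually (\<lambda>q. dist (?E (Inr \<gamma>) q) (?E (Inr \<gamma>) (Inr \<gamma>)) < \<epsilon>)
          (nbhd_filter ?E ?c ?X (Inr \<gamma>))"
        unfolding eventually_nbhd_filter
        by (intro exI[of _ k]) (auto simp: basic_nbhd_def nbhd_coords_def dist_real_def inverse_eq_divide)
    qed
    from i p show ?thesis
      by (cases rule: coord_cases) (simp_all add: base_tends old_tends new_tends self_tends)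
  qed
  have dense: "basic_nbhd ?E ?c ?X p k \<noteq> {}" if p: "p \<in> pts f" for p k
  proof (cases p)
    case (Inl x)
    then show ?thesis
      using p basic_nbhd_self[of p ?X ?E ?c k] by (auto simp: pts_def)
  next
    case (Inr \<beta>)
    then have \<beta>: "\<beta> \<in> dom f"
      using p by (auto simp: pts_def)
    \<comment> \<open>Half of the radius 1 / (k + 1): one d for bringing q close to the value 1,
      another for approximating q from \<open>X0\<close>.\<close>
    define d where "d = 1 / (2 * real (Suc k))"
    have "d > 0"
      by (simp add: d_def)
    from stage_cluster[OF valid[OF \<beta>] \<beta> ran[OF \<beta>] this]
    obtain q where q: "q \<in> pts (cut f \<beta>)" "?E (Inr \<beta>) q > 1 - d"
      using ran[OF \<beta>] by blast
    have "eventually (\<lambda>x. dist (?E (Inr \<beta>) x) (?E (Inr \<beta>) q) < d) (nbhd_filter ?E ?c ?X q)"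
      using stage_new_coord_tends[OF valid[OF \<beta>] \<beta> q(1)] nbhd_filter_mono[OF base_in_pts] \<open>d > 0\<close>
      by (intro tendstoD) (rule tendsto_mono[rotated])
    moreover have "basic_nbhd ?E ?c ?X q l \<noteq> {}" for l
      using prev[OF \<beta>] q(1)
      unfolding dense_system_def basic_nbhd_cut[OF q(1) base_in_pts, symmetric] by blast
    ultimately obtain l x where "x \<in> basic_nbhd ?E ?c ?X q l" "dist (?E (Inr \<beta>) x) (?E (Inr \<beta>) q) < d"
      unfolding eventually_nbhd_filter by (metis all_not_in_conv)
    then have x: "x \<in> ?X" "dist (?E (Inr \<beta>) x) (?E (Inr \<beta>) q) < d"
      using basic_nbhd_subset[of ?E ?c ?X q l] by blast+
    have "?E (Inr \<beta>) x < 1"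
      using stage_new_coord_bounds[OF valid[OF \<beta>] \<beta>, of x] x(1) base_in_pts by blast
    then have "\<bar>?E (Inr \<beta>) x - ?E (Inr \<beta>) (Inr \<beta>)\<bar> < d + d"
      using x(2) q(2) by (simp add: dist_real_def coord_def[of f _ "Inr \<beta>"])
    also have "d + d = 1 / Suc k"
      by (simp add: d_def field_simps)
    finally show ?thesis
      using x(1) unfolding Inr basic_nbhd_def nbhd_coords_def by auto
  qed
  show ?thesis
    unfolding dense_system_def
    using coordinate_system_from_dense[OF base_in_pts nbhd_coords_in tends dense] dense by blast
qed

text \<open>Well-founded induction with no distinction between successor and limit stages, as
  \<open>dense_system_step\<close> treats all of them alike.\<close>

lemma dense_system_of_stages:
  assumes "stages_ok e f"
  shows "dense_system f"
proof (rule dense_system_step[OF assms])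
  fix \<beta>
  show "dense_system (cut f \<beta>)"
    using wf_R
  proof (induction \<beta>)
    case (less \<beta>)
    show ?case
    proof (rule dense_system_step[OF stages_ok_cut[OF assms]])
      fix \<gamma> assume "\<gamma> \<in> dom (cut f \<beta>)"
      then have "(\<gamma>, \<beta>) \<in> R"
        by (auto simp: cut_def dom_def split: if_splits)
      then show "dense_system (cut (cut f \<beta>) \<gamma>)"
        using less by (simp add: cut_cut)
    qed
  qed
qed

lemma coord_in_unit:
  assumes ok: "stages_ok e f" and i: "i \<in> idx f" and p: "p \<in> pts f"
  shows "coord f i p \<in> {0..1}"
proof -
  have valid: "valid_stage e f \<beta>" if "\<beta> \<in> dom f" for \<beta>
    using ok that unfolding stages_ok_def by blast
  from i p show ?thesis
  proof (cases rule: coord_cases)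
    case base
    then show ?thesis
      using E0_bounds by (simp add: coord_def)
  next
    case (old \<beta>)
    then show ?thesis
      using stage_coord_bounds[OF valid] by simp
  next
    case (new \<gamma>)
    then show ?thesis
      using stage_new_coord_bounds[OF valid, of \<gamma> p] by simp
  next
    case self
    then show ?thesis
      by (simp add: coord_def)
  qed
qed

text \<open>Of two points, the one adjoined later has its own coordinate equal to 1, while this
  coordinate is below 1 at all earlier points.\<close>

lemma coord_separates:
  assumes ok: "stages_ok e f" and pq: "p \<in> pts f" "q \<in> pts f" "p \<noteq> q"
    and sep: "\<And>x y. x \<in> X0 \<Longrightarrow> y \<in> X0 \<Longrightarrow> x \<noteq> y \<Longrightarrow> \<exists>i\<in>I0. E0 i x \<noteq> E0 i y"
  shows "\<exists>i\<in>idx f. coord f i p \<noteq> coord f i q"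
proof -
  have valid: "valid_stage e f \<beta>" if "\<beta> \<in> dom f" for \<beta>
    using ok that unfolding stages_ok_def by blast
  have new: "\<exists>i\<in>idx f. coord f i (Inr \<beta>) \<noteq> coord f i z"
    if "\<beta> \<in> dom f" "z \<in> pts (cut f \<beta>)" for \<beta> z
    using stage_new_coord_bounds[OF valid[OF that(1)] that] that(1)
    by (intro bexI[of _ "Inr \<beta>"]) (auto simp: coord_def[of f _ "Inr \<beta>"] idx_def)
  consider x y where "p = Inl x" "q = Inl y" "x \<in> X0" "y \<in> X0" "x \<noteq> y"
    | \<beta> where "p = Inr \<beta>" "\<beta> \<in> dom f" "q \<in> pts (cut f \<beta>)"
    | \<beta> where "q = Inr \<beta>" "\<beta> \<in> dom f" "p \<in> pts (cut f \<beta>)"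
  proof (cases p)
    case (Inl x)
    then show thesis
      using pq that(1,3) by (cases q) auto
  next
    case (Inr \<beta>)
    then show thesis
      using pq that(2,3) R_cases[of \<beta>] by (cases q) (simp_all, metis)
  qed
  then show ?thesis
  proof cases
    case 1
    then show ?thesis
      using sep[of x y] by (auto simp: coord_def intro!: bexI[of _ "Inl _"])
  next
    case 2
    then show ?thesis
      using new by blast
  next
    case 3
    then show ?thesis
      using new[of \<beta> p] by (metis (no_types))
  qed
qed

end

section \<open>The topology of a coordinate system\<close>

context coordinate_system
begin

text \<open>Openness is expressed by the countable bases instead of by all coordinates. First
  countability can then be read off, and continuity of the coordinates is the assumption
  \<open>tends\<close>.\<close>

definition system_topology :: "'p topology" where
  "system_topology = topology (\<lambda>U. U \<subseteq> P \<and> (\<forall>p\<in>U. \<exists>k. basic_nbhd E c P p k \<subseteq> U))"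

lemma openin_system_topology:
  "openin system_topology U \<longleftrightarrow> U \<subseteq> P \<and> (\<forall>p\<in>U. \<exists>k. basic_nbhd E c P p k \<subseteq> U)"
proof -
  have "istopology (\<lambda>U. U \<subseteq> P \<and> (\<forall>p\<in>U. \<exists>k. basic_nbhd E c P p k \<subseteq> U))"
    unfolding istopology_def
  proof (intro conjI allI impI ballI)
    fix S T p
    assume S: "S \<subseteq> P \<and> (\<forall>p\<in>S. \<exists>k. basic_nbhd E c P p k \<subseteq> S)"
      and T: "T \<subseteq> P \<and> (\<forall>p\<in>T. \<exists>k. basic_nbhd E c P p k \<subseteq> T)"
    show "S \<inter> T \<subseteq> P"
      using S by blast
    assume "p \<in> S \<inter> T"
    then obtain k l where "basic_nbhd E c P p k \<subseteq> S" "basic_nbhd E c P p l \<subseteq> T"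
      using S T by blast
    then have "basic_nbhd E c P p (max k l) \<subseteq> S" "basic_nbhd E c P p (max k l) \<subseteq> T"
      using basic_nbhd_antimono[of k "max k l" E c P p] basic_nbhd_antimono[of l "max k l" E c P p]
      by (meson max.cobounded1 max.cobounded2 order_trans)+
    then show "\<exists>k. basic_nbhd E c P p k \<subseteq> S \<inter> T"
      by (intro exI[of _ "max k l"] Int_greatest)
  next
    fix \<K> p
    assume \<K>: "\<forall>K\<in>\<K>. K \<subseteq> P \<and> (\<forall>p\<in>K. \<exists>k. basic_nbhd E c P p k \<subseteq> K)"
    then show "\<Union>\<K> \<subseteq> P"
      by (simp add: Sup_least)
    assume "p \<in> \<Union>\<K>"
    then obtain K where K: "K \<in> \<K>" "p \<in> K"
      by (rule UnionE)
    with \<K> obtain k where "basic_nbhd E c P p k \<subseteq> K"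
      by meson
    then have "basic_nbhd E c P p k \<subseteq> \<Union>\<K>"
      using Union_upper[OF K(1)] by (rule order_trans)
    then show "\<exists>k. basic_nbhd E c P p k \<subseteq> \<Union>\<K>" ..
  qed
  then show ?thesis
    unfolding system_topology_def by (simp add: topology_inverse')
qed

lemma openin_basic_nbhd:
  assumes "p \<in> P"
  shows "openin system_topology (basic_nbhd E c P p k)"
  unfolding openin_system_topology
proof (intro conjI ballI basic_nbhd_subset)
  fix q assume "q \<in> basic_nbhd E c P p k"
  then show "\<exists>l. basic_nbhd E c P q l \<subseteq> basic_nbhd E c P p k"
    using eventually_basic_nbhd[OF assms] unfolding eventually_nbhd_filter subset_eq by simp
qed

lemma topspace_system_topology [simp]: "topspace system_topology = P"
proof
  show "topspace system_topology \<subseteq> P"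
    using openin_topspace[of system_topology] openin_system_topology by blast
  have "openin system_topology P"
    by (simp add: openin_system_topology basic_nbhd_subset)
  then show "P \<subseteq> topspace system_topology"
    by (rule openin_subset)
qed

lemma continuous_map_system_topology:
  fixes f :: "'p \<Rightarrow> real"
  assumes "\<And>p. p \<in> P \<Longrightarrow> (f \<longlongrightarrow> f p) (nbhd_filter E c P p)"
  shows "continuous_map system_topology euclideanreal f"
  unfolding continuous_map_def
proof (intro conjI allI impI)
  fix U :: "real set" assume "openin euclidean U"
  then have "open U"
    by simp
  have "\<exists>k. basic_nbhd E c P p k \<subseteq> {x \<in> P. f x \<in> U}" if "p \<in> P" "f p \<in> U" for p
  proof -
    have "eventually (\<lambda>x. f x \<in> U) (nbhd_filter E c P p)"
      using topological_tendstoD[OF assms[OF \<open>p \<in> P\<close>] \<open>open U\<close> \<open>f p \<in> U\<close>] .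
    then obtain k where "\<forall>x\<in>basic_nbhd E c P p k. f x \<in> U"
      unfolding eventually_nbhd_filter by (rule exE)
    then show ?thesis
      using basic_nbhd_subset[of E c P p k] by (intro exI[of _ k]) blast
  qed
  then show "openin system_topology {x \<in> topspace system_topology. f x \<in> U}"
    unfolding openin_system_topology by auto
qed simp

lemma first_countable_system_topology: "first_countable system_topology"
  unfolding first_countable_def
proof
  fix p assume "p \<in> topspace system_topology"
  then have p: "p \<in> P"
    by simp
  show "\<exists>\<B>. countable \<B> \<and> (\<forall>V\<in>\<B>. openin system_topology V) \<and>
      (\<forall>U. openin system_topology U \<and> p \<in> U \<longrightarrow> (\<exists>V\<in>\<B>. p \<in> V \<and> V \<subseteq> U))"
  proof (intro exI conjI allI impI)
    show "countable (range (basic_nbhd E c P p))"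
      by simp
    show "\<forall>V\<in>range (basic_nbhd E c P p). openin system_topology V"
      by (simp add: openin_basic_nbhd p)
    fix U assume "openin system_topology U \<and> p \<in> U"
    then obtain k where "basic_nbhd E c P p k \<subseteq> U"
      unfolding openin_system_topology by meson
    then show "\<exists>V\<in>range (basic_nbhd E c P p). p \<in> V \<and> V \<subseteq> U"
      using basic_nbhd_self[OF p] by (intro bexI[of _ "basic_nbhd E c P p k"]) auto
  qed
qed

lemma completely_regular_system_topology: "completely_regular_space system_topology"
  unfolding completely_regular_space_alt'
proof (intro allI impI)
  fix S p assume S: "openin system_topology S" and "p \<in> S"
  then obtain k where k: "basic_nbhd E c P p k \<subseteq> S" and p: "p \<in> P"
    unfolding openin_system_topology by blast
  \<comment> \<open>The distance from p in its first k + 1 coordinates, scaled by the inverse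
    radius: outside the neighbourhood one summand alone reaches the truncation level 1.\<close>
  define f where "f q = min 1 (real (Suc k) * (\<Sum>j\<le>k. \<bar>E (c p j) q - E (c p j) p\<bar>))" for q
  have "(f \<longlongrightarrow> f q) (nbhd_filter E c P q)" if "q \<in> P" for q
    unfolding f_def by (intro tendsto_intros tends c_in that p)
  then have "continuous_map system_topology euclideanreal f"
    by (rule continuous_map_system_topology)
  moreover have "f p = 0"
    by (simp add: f_def)
  moreover have "f q = 1" if q: "q \<in> P - S" for q
  proof -
    have "q \<notin> basic_nbhd E c P p k"
      using q k by blast
    then have "\<exists>j\<le>k. \<not> \<bar>E (c p j) q - E (c p j) p\<bar> < 1 / Suc k"
      using q unfolding basic_nbhd_def by blast
    then obtain j where j: "j \<le> k" "1 / Suc k \<le> \<bar>E (c p j) q - E (c p j) p\<bar>"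
      unfolding not_less by meson
    have "1 \<le> real (Suc k) * \<bar>E (c p j) q - E (c p j) p\<bar>"
      using j(2) by (simp add: field_simps)
    also have "\<dots> \<le> real (Suc k) * (\<Sum>j\<le>k. \<bar>E (c p j) q - E (c p j) p\<bar>)"
      using j(1) by (intro mult_left_mono member_le_sum) auto
    finally show ?thesis
      by (simp add: f_def)
  qed
  ultimately show "\<exists>f. continuous_map system_topology euclideanreal f \<and> f p = 0 \<and>
      f ` (topspace system_topology - S) \<subseteq> {1}"
    by (intro exI[of _ f]) auto
qed

lemma Hausdorff_system_topology:
  assumes "\<And>p q. p \<in> P \<Longrightarrow> q \<in> P \<Longrightarrow> p \<noteq> q \<Longrightarrow> \<exists>i\<in>J. E i p \<noteq> E i q"
  shows "Hausdorff_space system_topology"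
  unfolding Hausdorff_space_def
proof (intro allI impI)
  fix p q assume pq: "p \<in> topspace system_topology \<and> q \<in> topspace system_topology \<and> p \<noteq> q"
  then obtain i where i: "i \<in> J" "E i p \<noteq> E i q"
    using assms by auto
  obtain A B where AB: "open A" "open B" "E i p \<in> A" "E i q \<in> B" "A \<inter> B = {}"
    using hausdorff[OF i(2)] by blast
  have cont: "continuous_map system_topology euclideanreal (E i)"
    by (rule continuous_map_system_topology) (rule tends[OF _ i(1)])
  have "openin system_topology {x \<in> topspace system_topology. E i x \<in> D}" if "open D" for D
    using openin_continuous_map_preimage[OF cont, of D] that by simp
  then show "\<exists>U V. openin system_topology U \<and> openin system_topology V \<and> p \<in> U \<and> q \<in> V \<and> disjnt U V"
    using AB pq
    by (intro exI[of _ "{x \<in> topspace system_topology. E i x \<in> A}"]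
        exI[of _ "{x \<in> topspace system_topology. E i x \<in> B}"]) (auto simp: disjnt_def)
qed

text \<open>An infinite closed discrete set would contain an injective sequence, while every point p
  has a neighbourhood meeting the set in at most p: by discreteness if p belongs to it, by
  closedness otherwise.\<close>

lemma countably_compact_system_topology:
  assumes "\<And>s :: nat \<Rightarrow> 'p. range s \<subseteq> P \<Longrightarrow> \<exists>p\<in>P. \<forall>k. infinite {n. s n \<in> basic_nbhd E c P p k}"
  shows "countably_compact_space system_topology"
  unfolding countably_compact_space_def
proof (intro allI impI, rule ccontr)
  fix C assume C: "closedin system_topology C \<and> subtopology system_topology C = discrete_topology C"
    and "infinite C"
  then obtain s :: "nat \<Rightarrow> 'p" where s: "inj s" "range s \<subseteq> C"
    using infinite_countable_subset by blast
  have "C \<subseteq> P"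
    using C closedin_subset by fastforce
  then obtain p where p: "p \<in> P" "\<And>k. infinite {n. s n \<in> basic_nbhd E c P p k}"
    using assms[of s] s(2) by blast
  obtain U where U: "openin system_topology U" "p \<in> U" "U \<inter> C \<subseteq> {p}"
  proof (cases "p \<in> C")
    case True
    then have "openin (subtopology system_topology C) {p}"
      using C by simp
    then show ?thesis
      using that unfolding openin_subtopology by blast
  next
    case False
    then show ?thesis
      using that[of "P - C"] C p(1) by (auto simp: closedin_def)
  qed
  then obtain k where k: "basic_nbhd E c P p k \<subseteq> U"
    unfolding openin_system_topology by blast
  have "{n. s n \<in> basic_nbhd E c P p k} \<subseteq> s -` {p}"
    using k U(3) rangeI[of s] s(2) by blast
  moreover have "finite (s -` {p})"
    using s(1) by (simp add: finite_vimageI)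
  ultimately show False
    using p(2) finite_subset by blast
qed

end

section \<open>Existence of exhaustive constructions\<close>

context transfinite_extension
begin

text \<open>The sequences that call for a new point. Any other sequence in the current space already
  accumulates somewhere, and this persists.\<close>

definition unlimited :: "(nat \<Rightarrow> 'x + 'k) \<Rightarrow> ('x, 'i, 'k) construction \<Rightarrow> bool" where
  "unlimited s f \<longleftrightarrow> range s \<subseteq> pts f \<and>
     (\<forall>p\<in>pts f. \<exists>k. finite {n. s n \<in> basic_nbhd (coord f) nbhd_coords (pts f) p k})"

text \<open>Recursion along R. Before stage \<alpha> the earlier choices form a coordinate system
  with fewer than continuum many coordinates, as \<alpha> has fewer than continuum many
  predecessors, so \<open>obtain_limit_data\<close> applies.\<close>

lemma obtain_construction:
  fixes e :: "'k \<Rightarrow> nat \<Rightarrow> 'x + 'k"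
  assumes b: "bounding_number =o continuum" and F: "simple_P_c_point F"
    and I0: "|I0| <o |UNIV :: real set|" and R: "\<And>\<alpha>. |{\<beta>. (\<beta>, \<alpha>) \<in> R}| <o |UNIV :: real set|"
  obtains f where "stages_ok e f" "\<And>\<alpha>. unlimited (e \<alpha>) (cut f \<alpha>) \<Longrightarrow> \<alpha> \<in> dom f"
proof -
  \<comment> \<open>Prescribing \<open>None\<close> at the remaining stages ensures that every stage
    in the domain has a sequence of earlier points attached.\<close>
  define Q where "Q f \<alpha> y \<longleftrightarrow> (if unlimited (e \<alpha>) (cut f \<alpha>)
    then \<exists>v h. y = Some (v, h) \<and>
      limit_data (coord (cut f \<alpha>)) nbhd_coords (pts (cut f \<alpha>)) (idx (cut f \<alpha>)) (e \<alpha>) v h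
    else y = None)" for f :: "('x, 'i, 'k) construction" and \<alpha> y
  have ok: "\<beta> \<in> dom f \<Longrightarrow> valid_stage e f \<beta> \<and> range (e \<beta>) \<subseteq> pts (cut f \<beta>)"
    if "Q f \<beta> (f \<beta>)" for f \<beta>
    using that unfolding Q_def valid_stage_def unlimited_def by (auto split: if_splits)
  have "\<exists>f. \<forall>\<alpha>. Q f \<alpha> (f \<alpha>)"
  proof (rule dependent_wf_choice[OF wf_R])
    fix f g :: "('x, 'i, 'k) construction" and \<alpha> y
    assume "\<And>\<beta>. (\<beta>, \<alpha>) \<in> R \<Longrightarrow> f \<beta> = g \<beta>"
    then have "cut f \<alpha> = cut g \<alpha>"
      by (auto simp: cut_def)
    then show "Q f \<alpha> y = Q g \<alpha> y"
      by (simp add: Q_def)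
  next
    fix \<alpha> and f :: "('x, 'i, 'k) construction"
    assume prev: "\<And>\<beta>. (\<beta>, \<alpha>) \<in> R \<Longrightarrow> Q f \<beta> (f \<beta>)"
    let ?g = "cut f \<alpha>"
    have stages: "stages_ok e ?g"
      unfolding stages_ok_def
    proof
      fix \<beta> assume "\<beta> \<in> dom ?g"
      then have \<beta>: "(\<beta>, \<alpha>) \<in> R" "\<beta> \<in> dom f"
        by simp_all
      then show "valid_stage e ?g \<beta> \<and> range (e \<beta>) \<subseteq> pts (cut ?g \<beta>)"
        using ok[OF prev[OF \<beta>(1)] \<beta>(2)] unfolding valid_stage_def
        by (simp add: cut_cut) (simp add: cut_def)
    qed
    interpret coordinate_system "pts ?g" "idx ?g" "coord ?g" nbhd_coords
      using dense_system_of_stages[OF stages] unfolding dense_system_def by (rule conjunct1)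
    have "|idx ?g| <o |UNIV :: real set|"
    proof -
      have "|Inl ` I0 :: ('i + 'k) set| <o |UNIV :: real set|"
        using I0 card_of_image ordLeq_ordLess_trans by blast
      moreover have "|Inr ` {\<beta>. (\<beta>, \<alpha>) \<in> R} :: ('i + 'k) set| <o |UNIV :: real set|"
        using R card_of_image ordLeq_ordLess_trans by blast
      ultimately have "|Inl ` I0 \<union> Inr ` {\<beta>. (\<beta>, \<alpha>) \<in> R} :: ('i + 'k) set| <o |UNIV :: real set|"
        by (intro card_of_Un_ordLess_infinite) (auto simp: infinite_UNIV_char_0)
      moreover have "idx ?g \<subseteq> Inl ` I0 \<union> Inr ` {\<beta>. (\<beta>, \<alpha>) \<in> R}"
        by (auto simp: idx_def cut_def dom_def split: if_splits)
      ultimately show ?thesis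
        using card_of_mono1 ordLeq_ordLess_trans by blast
    qed
    then have "\<exists>v h. limit_data (coord ?g) nbhd_coords (pts ?g) (idx ?g) (e \<alpha>) v h"
      if "unlimited (e \<alpha>) ?g"
      using that coord_in_unit[OF stages] unfolding unlimited_def
      by (intro obtain_limit_data[OF b F]) auto
    then show "\<exists>y. Q f \<alpha> y"
      unfolding Q_def by auto
  qed
  then obtain f where f: "\<And>\<alpha>. Q f \<alpha> (f \<alpha>)"
    by blast
  show ?thesis
  proof (rule that)
    show "stages_ok e f"
      using ok[OF f] unfolding stages_ok_def by blast
    show "\<alpha> \<in> dom f" if "unlimited (e \<alpha>) (cut f \<alpha>)" for \<alpha>
      using f[of \<alpha>] that by (auto simp: Q_def)
  qed
qed

lemma construction_accumulation:
  assumes ok: "stages_ok e f" and limits: "\<And>\<alpha>. unlimited (e \<alpha>) (cut f \<alpha>) \<Longrightarrow> \<alpha> \<in> dom f"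
    and s: "range s \<subseteq> pts f" and stage: "\<And>b :: nat \<Rightarrow> 'k. \<exists>\<alpha>. e \<alpha> = s \<and> (\<forall>n. (b n, \<alpha>) \<in> R)"
  shows "\<exists>p\<in>pts f. \<forall>k. infinite {n. s n \<in> basic_nbhd (coord f) nbhd_coords (pts f) p k}"
proof -
  \<comment> \<open>For an original point \<open>projr\<close> is an unspecified stage; this is
    harmless, being just one more stage for \<alpha> to exceed.\<close>
  obtain \<alpha> where \<alpha>: "e \<alpha> = s" "\<And>n. (projr (s n), \<alpha>) \<in> R"
    using stage[of "\<lambda>n. projr (s n)"] by blast
  have s_cut: "s n \<in> pts (cut f \<alpha>)" for n
    using s \<alpha>(2)[of n] subsetD[OF s rangeI, of n] by (cases "s n") auto
  show ?thesis
  proof (cases "\<alpha> \<in> dom f")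
    case True
    then have valid: "valid_stage e f \<alpha>"
      using ok unfolding stages_ok_def by blast
    let ?h = "coord f (Inr \<alpha>)"
    have h_less: "?h (s n) < 1" for n
      using stage_new_coord_bounds[OF valid True s_cut] by blast
    have "infinite {n. s n \<in> basic_nbhd (coord f) nbhd_coords (pts f) (Inr \<alpha>) k}" for k
    proof
      let ?A = "{n. s n \<in> basic_nbhd (coord f) nbhd_coords (pts f) (Inr \<alpha>) k}"
      assume fin: "finite ?A"
      \<comment> \<open>If only finitely many terms were near the new point, d would bound their
        coordinate away from 1. A term with coordinate above 1 - d is within 1 / (k + 1), hence one
        of them, a contradiction.\<close>
      define d where "d = Min (insert (1 / Suc k) ((\<lambda>n. 1 - ?h (s n)) ` ?A))"
      have d_le: "d \<le> 1 / Suc k" "\<And>n. n \<in> ?A \<Longrightarrow> d \<le> 1 - ?h (s n)"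
        unfolding d_def using fin by (auto intro!: Min_le)
      have "d > 0"
        unfolding d_def using fin h_less by (subst Min_gr_iff) auto
      then obtain n where n: "?h (s n) > 1 - d"
        using stage_cluster[OF valid True, of d] s_cut \<alpha>(1) by auto
      have "\<bar>?h (s n) - coord f (Inr \<alpha>) (Inr \<alpha>)\<bar> < 1 / Suc k"
        using n d_le(1) h_less[of n] by (simp add: coord_def[of f _ "Inr \<alpha>"])
      then have "n \<in> ?A"
        using s by (auto simp: basic_nbhd_def nbhd_coords_def)
      then show False
        using d_le(2)[of n] n by simp
    qed
    then show ?thesis
      using True by (intro bexI[of _ "Inr \<alpha>"]) auto
  next
    case False
    then have "\<not> unlimited s (cut f \<alpha>)"
      using limits[of \<alpha>] \<alpha>(1) by blast
    then obtain p where p: "p \<in> pts (cut f \<alpha>)"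
      and inf: "\<And>k. infinite {n. s n \<in> basic_nbhd (coord (cut f \<alpha>)) nbhd_coords (pts (cut f \<alpha>)) p k}"
      using s_cut unfolding unlimited_def image_subset_iff by meson
    \<comment> \<open>The coordinates testing nearness to p stay the same, so its neighbourhoods
      only gain points.\<close>
    have sub: "{n. s n \<in> basic_nbhd (coord (cut f \<alpha>)) nbhd_coords (pts (cut f \<alpha>)) p k} \<subseteq>
        {n. s n \<in> basic_nbhd (coord f) nbhd_coords (pts f) p k}" for k
      unfolding basic_nbhd_cut[OF p order_refl] using pts_cut_subset[of f \<alpha>]
      by (auto simp: basic_nbhd_def)
    show ?thesis
      using p pts_cut_subset[of f \<alpha>] infinite_super[OF sub inf] by blast
  qed
qed

end

section \<open>Extending a given space\<close>

lemma exists_base_of: "\<exists>\<B>. base_of X \<B>"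
  unfolding base_of_def
proof
  show "openin X = arbitrary union_of (\<lambda>B. B \<in> Collect (openin X))"
  proof
    fix S
    show "openin X S = (arbitrary union_of (\<lambda>B. B \<in> Collect (openin X))) S"
      by (auto simp: union_of_def arbitrary_def intro: exI[of _ "{S}"])
  qed
qed

lemma base_of_nbhd:
  assumes "base_of X \<B>" "openin X U" "x \<in> U"
  obtains B where "B \<in> \<B>" "x \<in> B" "B \<subseteq> U"
proof -
  obtain \<U> where "\<U> \<subseteq> \<B>" "\<Union>\<U> = U"
    using assms(1,2) unfolding base_of_def union_of_def arbitrary_def by auto
  then show ?thesis
    using that assms(3) by blast
qed

lemma base_of_weight:
  obtains \<B> where "base_of X \<B>" "weight X = |\<B>|"
  using least_card_attained[of "base_of X"] exists_base_of[of X] unfolding weight_def by blast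

text \<open>One function for every pair of basic open sets that some continuous function separates
  suffices to generate the topology.\<close>

lemma obtain_base_coordinates:
  fixes X :: "'a topology"
  assumes reg: "completely_regular_space X" and fc: "first_countable X"
    and weight: "weight X <o |UNIV :: real set|"
  obtains I0 :: "('a \<Rightarrow> real) set" and c0 where
    "|I0| <o |UNIV :: real set|"
    "\<And>i. i \<in> I0 \<Longrightarrow> continuous_map X (top_of_set {0..1}) i"
    "\<And>x n. x \<in> topspace X \<Longrightarrow> c0 x n \<in> I0 \<and> c0 x n x = 0"
    "\<And>x U. openin X U \<Longrightarrow> x \<in> U \<Longrightarrow> \<exists>k. basic_nbhd (\<lambda>i. i) c0 (topspace X) x k \<subseteq> U"
proof -
  obtain \<B> where \<B>: "base_of X \<B>" "|\<B>| <o |UNIV :: real set|"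
    using base_of_weight[of X] weight by metis
  define sep where "sep = (\<lambda>(U, V) f. continuous_map X (top_of_set {0..1::real}) f \<and>
      (\<forall>y\<in>U. f y = 0) \<and> (\<forall>y\<in>topspace X - V. f y = 1))"
  define pick where "pick UV = (SOME f. sep UV f)" for UV
  have pick: "sep UV (pick UV)" if "sep UV f" for UV f
    unfolding pick_def by (rule someI[of "sep UV", OF that])
  define I0 where "I0 = pick ` {UV \<in> \<B> \<times> \<B>. \<exists>f. sep UV f}"
  have small: "|I0| <o |UNIV :: real set|"
  proof -
    have "|{UV \<in> \<B> \<times> \<B>. \<exists>f. sep UV f}| \<le>o |\<B> \<times> \<B>|"
      by (rule card_of_mono1) blast
    moreover have "|\<B> \<times> \<B>| <o |UNIV :: real set|"
      by (rule card_of_Times_ordLess[OF _ \<B>(2) \<B>(2)]) (simp add: infinite_UNIV_char_0)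
    ultimately show ?thesis
      unfolding I0_def using card_of_image ordLeq_transitive ordLeq_ordLess_trans by blast
  qed
  have cont: "continuous_map X (top_of_set {0..1}) i" if i: "i \<in> I0" for i
  proof -
    obtain UV f where "i = pick UV" "sep UV f"
      using i unfolding I0_def by blast
    then show ?thesis
      using pick[of UV f] by (cases UV) (simp add: sep_def)
  qed
  have separating: "\<exists>i\<in>I0. i x = 0 \<and> {y \<in> topspace X. i y < 1} \<subseteq> U"
    if U: "openin X U" "x \<in> U" for U x
  proof -
    obtain V where V: "V \<in> \<B>" "x \<in> V" "V \<subseteq> U"
      using base_of_nbhd[OF \<B>(1) U] .
    have "openin X V"
      using \<B>(1) V(1) unfolding base_of_def by (simp add: arbitrary_union_of_inc)
    then obtain f where f: "continuous_map X euclideanreal f" "f x = 0" "f ` (topspace X - V) \<subseteq> {1}"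
      using reg V(2) unfolding completely_regular_space_alt' by blast
    define W where "W = {y \<in> topspace X. f y \<in> {..<1/2}}"
    have "openin X W"
      unfolding W_def by (rule openin_continuous_map_preimage[OF f(1)]) simp
    moreover have "x \<in> W"
      using f(2) U openin_subset by (fastforce simp: W_def)
    ultimately obtain B where B: "B \<in> \<B>" "x \<in> B" "B \<subseteq> W"
      using base_of_nbhd[OF \<B>(1)] by blast
    \<comment> \<open>The function f vanishes only at x for certain. Rescaling makes it 0 on all of
      B, so that the pair (B, V), independent of x, determines which function is needed.\<close>
    define g where "g y = max 0 (min 1 (2 * f y - 1))" for y
    have "continuous_map X euclideanreal g"
      unfolding g_def by (intro continuous_intros f(1))
    then have "sep (B, V) g"
      using f(3) B(3) by (auto simp: sep_def continuous_map_in_subtopology g_def W_def)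
    then have "pick (B, V) \<in> I0" "sep (B, V) (pick (B, V))"
      using B(1) V(1) pick unfolding I0_def by blast+
    then show ?thesis
      using B(2) V(3) by (intro bexI[of _ "pick (B, V)"]) (force simp: sep_def)+
  qed
  have "\<exists>c :: nat \<Rightarrow> 'a \<Rightarrow> real. (\<forall>n. c n \<in> I0 \<and> c n x = 0) \<and>
      (\<forall>U. openin X U \<longrightarrow> x \<in> U \<longrightarrow> (\<exists>n. {y \<in> topspace X. c n y < 1} \<subseteq> U))"
    if x: "x \<in> topspace X" for x
  proof -
    obtain \<C> where \<C>: "countable \<C>" "\<And>V. V \<in> \<C> \<Longrightarrow> openin X V"
      "\<And>U. openin X U \<Longrightarrow> x \<in> U \<Longrightarrow> \<exists>V\<in>\<C>. x \<in> V \<and> V \<subseteq> U"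
      using fc x unfolding first_countable_def by meson
    define \<D> where "\<D> = {V \<in> \<C>. x \<in> V}"
    have "\<D> \<noteq> {}"
      using \<C>(3)[OF openin_topspace x] by (auto simp: \<D>_def)
    moreover have "countable \<D>"
      using \<C>(1) by (simp add: \<D>_def)
    ultimately obtain W :: "nat \<Rightarrow> 'a set" where W: "range W = \<D>"
      by (metis uncountable_def)
    have "\<exists>i\<in>I0. i x = 0 \<and> {y \<in> topspace X. i y < 1} \<subseteq> W n" for n
      using W \<C>(2) by (intro separating) (auto simp: \<D>_def)
    then obtain c where c: "\<And>n. c n \<in> I0 \<and> c n x = 0 \<and> {y \<in> topspace X. c n y < 1} \<subseteq> W n"
      by metis
    have "\<exists>n. {y \<in> topspace X. c n y < 1} \<subseteq> U" if U: "openin X U" "x \<in> U" for U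
    proof -
      obtain V where "V \<in> \<D>" "V \<subseteq> U"
        using \<C>(3)[OF U] by (auto simp: \<D>_def)
      then obtain n where "W n \<subseteq> U"
        using W by blast
      then have "{y \<in> topspace X. c n y < 1} \<subseteq> U"
        using c[of n] by (meson order_trans)
      then show ?thesis ..
    qed
    then show ?thesis
      using c by (intro exI[of _ c] conjI allI impI) simp_all
  qed
  then have "\<exists>c0 :: 'a \<Rightarrow> nat \<Rightarrow> 'a \<Rightarrow> real. \<forall>x\<in>topspace X. (\<forall>n. c0 x n \<in> I0 \<and> c0 x n x = 0) \<and>
      (\<forall>U. openin X U \<longrightarrow> x \<in> U \<longrightarrow> (\<exists>n. {y \<in> topspace X. c0 x n y < 1} \<subseteq> U))"
    by (intro bchoice ballI)
  then obtain c0 :: "'a \<Rightarrow> nat \<Rightarrow> 'a \<Rightarrow> real" where c0_all: "\<forall>x\<in>topspace X. (\<forall>n. c0 x n \<in> I0 \<and> c0 x n x = 0) \<and>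
      (\<forall>U. openin X U \<longrightarrow> x \<in> U \<longrightarrow> (\<exists>n. {y \<in> topspace X. c0 x n y < 1} \<subseteq> U))"
    by (rule exE)
  then have c0: "c0 x n \<in> I0 \<and> c0 x n x = 0" if "x \<in> topspace X" for x n
    using that by simp
  have c0_base: "\<exists>n. {y \<in> topspace X. c0 x n y < 1} \<subseteq> U" if "openin X U" "x \<in> U" "x \<in> topspace X" for x U
    using bspec[OF c0_all that(3)] that(1,2) by simp
  show ?thesis
  proof (rule that[OF small cont c0])
    fix x U assume U: "openin X U" "x \<in> U"
    then have x: "x \<in> topspace X"
      using openin_subset by blast
    obtain n where n: "{y \<in> topspace X. c0 x n y < 1} \<subseteq> U"
      using c0_base[OF U x] by (rule exE)
    have "y \<in> U" if "y \<in> basic_nbhd (\<lambda>i. i) c0 (topspace X) x n" for y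
    proof -
      have y: "y \<in> topspace X" "\<bar>c0 x n y - c0 x n x\<bar> < 1 / Suc n"
        using that by (auto simp: basic_nbhd_def)
      \<comment> \<open>The neighbourhood of index n controls the coordinate \<open>c0 x n\<close>
        itself with radius at most 1, which is what the choice of n requires.\<close>
      have "1 / real (Suc n) \<le> 1"
        by simp
      then have "c0 x n y < 1"
        using y(2) c0[OF x, of n] by linarith
      then show ?thesis
        using n y(1) by blast
    qed
    then show "\<exists>k. basic_nbhd (\<lambda>i. i) c0 (topspace X) x k \<subseteq> U"
      by blast
  qed
qed

text \<open>Every sequence is listed continuum often, hence beyond any countable set of stages.\<close>

lemma obtain_cofinal_enumeration:
  fixes C :: "'b set"
  assumes b: "bounding_number =o continuum" and C: "C \<lesssim> (UNIV :: real set)"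
    and R: "\<And>\<alpha>. |{\<beta>. (\<beta>, \<alpha>) \<in> R}| <o |UNIV :: real set|" and "total R"
  obtains e :: "real \<Rightarrow> nat \<Rightarrow> 'b" where
    "\<And>s (\<beta> :: nat \<Rightarrow> real). range s \<subseteq> C \<Longrightarrow> \<exists>\<alpha>. e \<alpha> = s \<and> (\<forall>n. (\<beta> n, \<alpha>) \<in> R)"
proof -
  let ?S = "{s :: nat \<Rightarrow> 'b. range s \<subseteq> C}"
  have "|?S| \<le>o |UNIV :: real set|"
    using function_space_lepoll_reals[OF C] by (simp add: lepoll_iff_card_of)
  \<comment> \<open>The real factor gives each sequence continuum many codes.\<close>
  then have "|?S \<times> (UNIV :: real set)| \<le>o |UNIV :: real set|"
    using card_of_Times_mono1 card_of_Times_same_infinite[OF infinite_UNIV_char_0]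
      ordLeq_ordIso_trans by blast
  then obtain J :: "(nat \<Rightarrow> 'b) \<times> real \<Rightarrow> real" where J: "inj_on J (?S \<times> UNIV)"
    unfolding card_of_ordLeq[symmetric] by blast
  define e where "e \<alpha> = fst (inv_into (?S \<times> UNIV) J \<alpha>)" for \<alpha>
  have e: "e (J (s, y)) = s" if "range s \<subseteq> C" for s y
    unfolding e_def using inv_into_f_f[OF J, of "(s, y)"] that by simp
  show ?thesis
  proof (rule that)
    fix s :: "nat \<Rightarrow> 'b" and \<beta> :: "nat \<Rightarrow> real" assume s: "range s \<subseteq> C"
    \<comment> \<open>The stages not beyond \<open>\<beta> n\<close>. Their union is smaller than
      the continuum, so some code of s lies outside it, and totality places that code above every
      \<open>\<beta> n\<close>.\<close>
    define A where "A n = insert (\<beta> n) {\<alpha>. (\<alpha>, \<beta> n) \<in> R}" for n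
    have "|A n| <o |UNIV :: real set|" for n
    proof -
      have "|{\<beta> n} \<union> {\<alpha>. (\<alpha>, \<beta> n) \<in> R}| <o |UNIV :: real set|"
        by (intro card_of_Un_ordLess_infinite R countable_below_continuum) (auto simp: infinite_UNIV_char_0)
      then show ?thesis
        by (simp add: A_def)
    qed
    then have "|\<Union>n. A n| <o |UNIV :: real set|"
      by (rule countable_union_below_continuum[OF b])
    moreover have "|UNIV :: real set| \<le>o |range (\<lambda>y. J (s, y))|"
      unfolding card_of_ordLeq[symmetric]
      using J s by (intro exI[of _ "\<lambda>y. J (s, y)"]) (auto simp: inj_on_def)
    ultimately have "\<not> range (\<lambda>y. J (s, y)) \<subseteq> (\<Union>n. A n)"
      using card_of_mono1 not_card_of_ordLess ordLeq_transitive by metis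
    then obtain y where y: "\<And>n. J (s, y) \<notin> A n"
      by blast
    have "(\<beta> n, J (s, y)) \<in> R" for n
      using y[of n] \<open>total R\<close> unfolding A_def total_on_def by blast
    then show "\<exists>\<alpha>. e \<alpha> = s \<and> (\<forall>n. (\<beta> n, \<alpha>) \<in> R)"
      using e[OF s] by blast
  qed
qed

theorem theorem3p8:
  fixes X :: "'a topology"
  assumes "bounding_number =o continuum"
    and "\<exists>F. simple_P_c_point F"
    and "Tychonoff_space X" and "first_countable X" and "weight X <o continuum"
  shows "\<exists>Y :: ('a + real) topology.
           Tychonoff_space Y \<and> first_countable Y \<and> countably_compact_space Y \<and>
           densely_embeds X Y"
proof -
  obtain F where F: "simple_P_c_point F"
    using assms(2) by blast
  have reg: "completely_regular_space X" and Haus: "Hausdorff_space X"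
    using assms(3) unfolding Tychonoff_space_def by blast+
  have weight: "weight X <o |UNIV :: real set|"
    using assms(5) by (simp add: continuum_def)
  obtain I0 :: "('a \<Rightarrow> real) set" and c0 where small: "|I0| <o |UNIV :: real set|"
    and cont: "\<And>i. i \<in> I0 \<Longrightarrow> continuous_map X (top_of_set {0..1}) i"
    and c0: "\<And>x n. x \<in> topspace X \<Longrightarrow> c0 x n \<in> I0 \<and> c0 x n x = 0"
    and local_base: "\<And>x U. openin X U \<Longrightarrow> x \<in> U \<Longrightarrow> \<exists>k. basic_nbhd (\<lambda>i. i) c0 (topspace X) x k \<subseteq> U"
    using obtain_base_coordinates[OF reg assms(4) weight] by blast
  have contR: "continuous_map X euclideanreal i" if "i \<in> I0" for i
    using cont[OF that] by (simp add: continuous_map_in_subtopology)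
  have T1: "\<exists>k. y \<notin> basic_nbhd (\<lambda>i. i) c0 (topspace X) x k"
    if xy: "x \<in> topspace X" "y \<in> topspace X" "x \<noteq> y" for x y
  proof -
    obtain U V where "openin X U" "x \<in> U" "y \<in> V" "disjnt U V"
      using Haus xy unfolding Hausdorff_space_def by meson
    then show ?thesis
      using local_base[of U x] by (meson disjnt_iff subsetD)
  qed
  have sep: "\<exists>i\<in>I0. i x \<noteq> i y" if xy: "x \<in> topspace X" "y \<in> topspace X" "x \<noteq> y" for x y
  proof (rule ccontr)
    assume "\<not> ?thesis"
    then have "c0 x j y = c0 x j x" for j
      using c0[OF xy(1), of j] by metis
    then show False
      using T1[OF xy] xy(2) by (simp add: basic_nbhd_def)
  qed
  \<comment> \<open>The coordinates \<open>c0 x\<close> vanish at x and determine it, so points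
    inject into sequences from \<open>I0\<close>, of which there are at most continuum many.\<close>
  have card_X: "topspace X \<lesssim> (UNIV :: real set)"
  proof -
    have "inj_on c0 (topspace X)"
    proof (rule inj_onI, rule ccontr)
      fix x y assume xy: "x \<in> topspace X" "y \<in> topspace X" "c0 x = c0 y" "x \<noteq> y"
      have "c0 x j y = c0 x j x" for j
        using c0[OF xy(1), of j] c0[OF xy(2), of j] xy(3) by simp
      then show False
        using T1[OF xy(1,2,4)] xy(2) by (simp add: basic_nbhd_def)
    qed
    moreover have "c0 ` topspace X \<subseteq> {s. range s \<subseteq> I0}"
      using c0 by blast
    ultimately have "topspace X \<lesssim> {s :: nat \<Rightarrow> 'a \<Rightarrow> real. range s \<subseteq> I0}"
      unfolding lepoll_def by blast
    moreover have "I0 \<lesssim> (UNIV :: real set)"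
      using small by (simp add: lepoll_iff_card_of ordLess_imp_ordLeq)
    ultimately show ?thesis
      using function_space_lepoll_reals lepoll_trans by blast
  qed
  have base: "coordinate_system (topspace X) I0 (\<lambda>i. i) c0"
  proof
    fix x i assume x: "x \<in> topspace X" and i: "i \<in> I0"
    show "(i \<longlongrightarrow> i x) (nbhd_filter (\<lambda>i. i) c0 (topspace X) x)"
    proof (rule topological_tendstoI)
      fix S assume S: "open S" "i x \<in> S"
      have "openin X {y \<in> topspace X. i y \<in> S}"
        by (rule openin_continuous_map_preimage[OF contR[OF i]]) (simp add: S)
      then obtain k where "basic_nbhd (\<lambda>i. i) c0 (topspace X) x k \<subseteq> {y \<in> topspace X. i y \<in> S}"
        using local_base x S(2) by blast
      then show "eventually (\<lambda>y. i y \<in> S) (nbhd_filter (\<lambda>i. i) c0 (topspace X) x)"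
        unfolding eventually_nbhd_filter by blast
    qed
  qed (use c0 in blast)
  \<comment> \<open>The strict part of a cardinal well-order, so that every stage has fewer than
    continuum many predecessors.\<close>
  define R where "R = |UNIV :: real set| - Id"
  have wo: "well_order_on UNIV |UNIV :: real set|"
    by (rule card_of_well_order_on)
  have R: "wf R" "trans R" "total R"
    using wo unfolding R_def well_order_on_def linear_order_on_def partial_order_on_def preorder_on_def
    by (auto intro: trans_diff_Id)
  have R_small: "|{\<beta>. (\<beta>, \<alpha>) \<in> R}| <o |UNIV :: real set|" for \<alpha>
  proof -
    have "{\<beta>. (\<beta>, \<alpha>) \<in> R} = underS |UNIV :: real set| \<alpha>"
      by (auto simp: R_def underS_def)
    then show ?thesis
      using card_of_underS[OF card_of_Card_order, of \<alpha> "UNIV :: real set"] by (simp add: Field_card_of)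
  qed
  interpret transfinite_extension R "topspace X" I0 "\<lambda>i. i" c0
  proof (rule transfinite_extension.intro[OF R base])
    show "i x \<in> {0..1}" if "i \<in> I0" "x \<in> topspace X" for i x
      using cont[OF that(1)] that(2) by (auto simp: continuous_map_in_subtopology)
  qed
  \<comment> \<open>All points that could ever occur: the sequences must be enumerated before it is
    known which stages adjoin a point.\<close>
  let ?C = "Inl ` topspace X \<union> range Inr :: ('a + real) set"
  have "|?C| \<le>o |UNIV :: real set|"
  proof (rule card_of_Un_ordLeq_infinite_Field)
    show "|Inl ` topspace X :: ('a + real) set| \<le>o |UNIV :: real set|"
      using card_of_image card_X ordLeq_transitive unfolding lepoll_iff_card_of by blast
  qed (rule card_of_Card_order | simp add: infinite_UNIV_char_0 card_of_image Field_card_of)+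
  then have "?C \<lesssim> (UNIV :: real set)"
    by (simp add: lepoll_iff_card_of)
  then obtain e :: "real \<Rightarrow> nat \<Rightarrow> 'a + real" where
    e: "\<And>s (\<beta> :: nat \<Rightarrow> real). range s \<subseteq> ?C \<Longrightarrow> \<exists>\<alpha>. e \<alpha> = s \<and> (\<forall>n. (\<beta> n, \<alpha>) \<in> R)"
    using obtain_cofinal_enumeration[OF assms(1) _ R_small R(3)] by metis
  obtain f where f: "stages_ok e f" "\<And>\<alpha>. unlimited (e \<alpha>) (cut f \<alpha>) \<Longrightarrow> \<alpha> \<in> dom f"
    using obtain_construction[OF assms(1) F small R_small] by blast
  have dense: "dense_system f"
    by (rule dense_system_of_stages[OF f(1)])
  interpret Y: coordinate_system "pts f" "idx f" "coord f" nbhd_coords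
    using dense unfolding dense_system_def by (rule conjunct1)
  let ?Y = "Y.system_topology"
  have "Tychonoff_space ?Y"
    unfolding Tychonoff_space_def
    using Y.completely_regular_system_topology Y.Hausdorff_system_topology coord_separates[OF f(1) _ _ _ sep]
    by blast
  moreover have "countably_compact_space ?Y"
  proof (rule Y.countably_compact_system_topology)
    fix s :: "nat \<Rightarrow> 'a + real" assume s: "range s \<subseteq> pts f"
    then have "range s \<subseteq> ?C"
      by (auto simp: pts_def)
    then show "\<exists>p\<in>pts f. \<forall>k. infinite {n. s n \<in> basic_nbhd (coord f) nbhd_coords (pts f) p k}"
      using construction_accumulation[OF f s e] by blast
  qed
  moreover have "densely_embeds X ?Y"
    unfolding densely_embeds_def
  proof (intro exI conjI)
    \<comment> \<open>An original point keeps its original coordinates in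
      \<open>nbhd_coords\<close>, so its neighbourhoods in the extension trace exactly the old ones;
      both directions of the embedding rest on this.\<close>
    have trace: "basic_nbhd (coord f) nbhd_coords (pts f) (Inl x) k \<inter> Inl ` topspace X =
        Inl ` basic_nbhd (\<lambda>i. i) c0 (topspace X) x k" for x k
      by (auto simp: basic_nbhd_def nbhd_coords_def coord_def)
    have Inl_cont: "openin X {x \<in> topspace X. Inl x \<in> U}" if U: "openin ?Y U" for U
    proof (subst openin_subopen, intro ballI)
      fix x assume "x \<in> {x \<in> topspace X. Inl x \<in> U}"
      then have x: "x \<in> topspace X" "Inl x \<in> U"
        by auto
      then obtain k where k: "basic_nbhd (coord f) nbhd_coords (pts f) (Inl x) k \<subseteq> U"
        using U unfolding Y.openin_system_topology by meson
      have "openin X {y \<in> topspace X. c0 x j y \<in> ball (c0 x j x) (1 / Suc k)}" for j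
        using c0[OF x(1), of j] by (intro openin_continuous_map_preimage[OF contR]) auto
      then have "openin X (\<Inter>j\<in>{..k}. {y \<in> topspace X. c0 x j y \<in> ball (c0 x j x) (1 / Suc k)})"
        by (intro openin_INT2) auto
      also have "(\<Inter>j\<in>{..k}. {y \<in> topspace X. c0 x j y \<in> ball (c0 x j x) (1 / Suc k)}) =
          basic_nbhd (\<lambda>i. i) c0 (topspace X) x k"
        by (auto simp: basic_nbhd_def dist_real_def abs_minus_commute)
      finally have "openin X (basic_nbhd (\<lambda>i. i) c0 (topspace X) x k)" .
      moreover have "basic_nbhd (\<lambda>i. i) c0 (topspace X) x k \<subseteq> {x \<in> topspace X. Inl x \<in> U}"
        using k trace[of x k] basic_nbhd_subset by fastforce
      ultimately show "\<exists>T. openin X T \<and> x \<in> T \<and> T \<subseteq> {x \<in> topspace X. Inl x \<in> U}"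
        using basic_nbhd_self[OF x(1)] by metis
    qed
    have Inl_open: "\<exists>V. openin ?Y V \<and> V \<inter> Inl ` topspace X = Inl ` U" if U: "openin X U" for U
    proof -
      have UX: "U \<subseteq> topspace X"
        by (rule openin_subset[OF U])
      have "\<forall>x\<in>U. \<exists>k. basic_nbhd (\<lambda>i. i) c0 (topspace X) x k \<subseteq> U"
        using local_base[OF U] by blast
      then obtain k where k: "\<And>x. x \<in> U \<Longrightarrow> basic_nbhd (\<lambda>i. i) c0 (topspace X) x (k x) \<subseteq> U"
        by metis
      let ?V = "\<Union>x\<in>U. basic_nbhd (coord f) nbhd_coords (pts f) (Inl x) (k x)"
      have "openin ?Y ?V"
        using UX by (intro openin_Union) (auto intro!: Y.openin_basic_nbhd)
      moreover have "?V \<inter> Inl ` topspace X = Inl ` (\<Union>x\<in>U. basic_nbhd (\<lambda>i. i) c0 (topspace X) x (k x))"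
        unfolding image_UN trace[symmetric] by blast
      moreover have "(\<Union>x\<in>U. basic_nbhd (\<lambda>i. i) c0 (topspace X) x (k x)) = U"
      proof
        show "U \<subseteq> (\<Union>x\<in>U. basic_nbhd (\<lambda>i. i) c0 (topspace X) x (k x))"
        proof
          fix x assume "x \<in> U"
          then show "x \<in> (\<Union>x\<in>U. basic_nbhd (\<lambda>i. i) c0 (topspace X) x (k x))"
            using UX by (intro UN_I[of x] basic_nbhd_self) auto
        qed
      qed (rule UN_least[OF k])
      ultimately show ?thesis
        by (intro exI[of _ ?V]) simp
    qed
    have "continuous_map X ?Y Inl"
      using Inl_cont base_in_pts[of f] unfolding continuous_map_def by auto
    then have "continuous_map X (subtopology ?Y (Inl ` topspace X)) Inl"
      by (simp add: continuous_map_in_subtopology)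
    moreover have "open_map X (subtopology ?Y (Inl ` topspace X)) Inl"
      unfolding open_map_def openin_subtopology using Inl_open by metis
    ultimately show "embedding_map X ?Y Inl"
      unfolding embedding_map_def
      by (intro bijective_open_imp_homeomorphic_map) (use base_in_pts in \<open>auto simp: inj_on_def\<close>)
    show "?Y closure_of (Inl ` topspace X) = topspace ?Y"
    proof
      show "topspace ?Y \<subseteq> ?Y closure_of (Inl ` topspace X)"
      proof
        fix p assume "p \<in> topspace ?Y"
        then have p: "p \<in> pts f"
          by simp
        have "\<exists>y\<in>Inl ` topspace X. y \<in> T" if T: "p \<in> T" "openin ?Y T" for T
        proof -
          obtain k where k: "basic_nbhd (coord f) nbhd_coords (pts f) p k \<subseteq> T"
            using T unfolding Y.openin_system_topology by meson
          obtain q where "q \<in> basic_nbhd (coord f) nbhd_coords (Inl ` topspace X) p k"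
            using dense p unfolding dense_system_def by blast
          then show ?thesis
            using k base_in_pts[of f] unfolding basic_nbhd_def by blast
        qed
        then show "p \<in> ?Y closure_of (Inl ` topspace X)"
          using p unfolding in_closure_of by simp
      qed
    qed (rule closure_of_subset_topspace)
  qed
  ultimately show ?thesis
    using Y.first_countable_system_topology by blast
qed

end
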